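(* Let $f\in\mathbb{F}_2[x]$ be irreducible with $\deg(f)=m$. Suppose that $\boldsymbol g^*=(g_1^*,\ldots,g_s^* )\in G_m^s$ is constructed by the following component-by-component algorithm: $g_1^*=1$; and for $d=2,3,\ldots,s$, with $g_1^*,\ldots,g_{d-1}^*$ already chosen, $g_d^*\in G_m$ is a minimizer of $B_{\boldsymbol\gamma}((g_1^*,\ldots,g_{d-1}^*,g_d),f)$ as a function of $g_d$ over $G_m$. Then for all $d\in[s]$ we have $$\mathrm{wce}(\mathcal P((g_1^*,\ldots,g_d^* ),f);\infty,d,\boldsymbol\gamma,\varphi)\le\frac1{2^m}\sum_{\emptyset\ne\mathfrak u\subseteq[d]}\gamma_{\mathfrak u}\left(2^{|\mathfrak u|}+\left(\frac m2\right)^{|\mathfrak u|}\right)\prod_{i\in\mathfrak u}(b_i-a_i).$$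
   Context: Setting. Let $s,m\in\mathbb{N}$, $[d]=\{1,\ldots,d\}$, $-\infty<a_i<b_i<\infty$ for $i\in[s]$. For each $i\in[s]$ let $\varphi_i:[a_i,b_i]\to\mathbb{R}$ be a probability density function with respect to Lebesgue measure and let $\Phi_i(x)=\int_{a_i}^x\varphi_i(y)\,\mathrm{d}y$, which is assumed to be invertible as a map $[a_i,b_i]\to[0,1]$. Let $\boldsymbol\gamma=\{\gamma_{\mathfrak u}:\mathfrak u\subseteq[s]\}$ be positive real numbers (weights). In dimension $d\le s$ write $[\boldsymbol a,\boldsymbol b]=\prod_{i=1}^d[a_i,b_i]$, $\varphi(\boldsymbol x)=\prod_{i=1}^d\varphi_i(x_i)$, $\Phi^{-1}(\boldsymbol x)=(\Phi_1^{-1}(x_1),\ldots,\Phi_d^{-1}(x_d))$ for $\boldsymbol x\in[0,1]^d$. Norm and worst-case error ($p=\infty$). For $\mathfrak u=\{u_1<\cdots<u_k\}\subseteq[d]$ let $\frac{\partial^{|\mathfrak u|}F}{\partial\boldsymbol x_{\mathfrak u}}=\frac{\partial^kF}{\partial x_{u_1}\cdots\partial x_{u_k}}$ (equal to $F$ for $\mathfrak u=\emptyset$). For $F:[\boldsymbol a,\boldsymbol b]\to\mathbb{R}$ for which these mixed partial derivatives exist, $\|F\|_{\infty,d,\boldsymbol\gamma}=\max_{\mathfrak u\subseteq[d]}\frac1{\gamma_{\mathfrak u}}\sup_{\boldsymbol x\in[\boldsymbol a,\boldsymbol b]}\left|\frac{\partial^{|\mathfrak u|}F}{\partial\boldsymbol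 x_{\mathfrak u}}(\boldsymbol x)\right|$. For points $\mathcal P=\{\boldsymbol y_0,\ldots,\boldsymbol y_{N-1}\}$ in $[0,1]^d$ (counted with multiplicity), $\mathrm{wce}(\mathcal P;\infty,d,\boldsymbol\gamma,\varphi)=\sup_{\|F\|_{\infty,d,\boldsymbol\gamma}\le1}\left|\frac1N\sum_{n=0}^{N-1}F(\Phi^{-1}(\boldsymbol y_n))-\int_{[\boldsymbol a,\boldsymbol b]}F(\boldsymbol x)\varphi(\boldsymbol x)\,\mathrm d\boldsymbol x\right|$. Polynomial lattice point sets. $G_m=\{h\in\mathbb{F}_2[x]:\deg(h)<m\}$ (including $0$). For a formal Laurent series $g=\sum_{k=w}^\infty a_kx^{-k}\in\mathbb{F}_2((x^{-1}))$ let $\{g\}_m=\sum_{k=\max(1,w)}^ma_k2^{-k}\in[0,1)$ (and $\{0\}_m=0$). For $f\in\mathbb{F}_2[x]$ with $\deg f=m$ and $\boldsymbol g=(g_1,\ldots,g_d)\in\mathbb{F}_2[x]^d$, the polynomial lattice point set $\mathcal P(\boldsymbol g,f)$ consists of the $2^m$ points (counted with multiplicity) $\boldsymbol x_h=(\{hg_1/f\}_m,\ldots,\{hg_d/f\}_m)$, $h\in G_m$. Walsh functions. For $x\in[0,1)$ with dyadic expansion $x=\frac{\xi_1}2+\frac{\xi_2}{2^2}+\cdots$ (infinitely many digits different from $1$) and $k=\kappa_0+\kappa_12+\cdots+\kappa_{r-1}2^{r-1}\in\mathbb{N}_0$ with $\kappa_j\in\{0,1\}$, $\mathrm{wal}_k(x)=(-1)^{\kappa_0\xi_1+\cdots+\kappa_{r-1}\xi_r}$;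 $\mathrm{wal}_{\boldsymbol k_{\mathfrak u}}(\boldsymbol y_{\mathfrak u})=\prod_{i\in\mathfrak u}\mathrm{wal}_{k_i}(y_i)$. The function $\mu$. $\mu(0)=0$, $\mu(k)=l$ if $2^{l-1}\le k<2^l$; $\mu(\boldsymbol k_{\mathfrak u})=\sum_{i\in\mathfrak u}\mu(k_i)$. Figure of merit. For points $\mathcal P=\{\boldsymbol y_0,\ldots,\boldsymbol y_{2^m-1}\}$ in $[0,1)^d$ and $\emptyset\ne\mathfrak u\subseteq[d]$, with $\boldsymbol y_{n,\mathfrak u}$ the projection of $\boldsymbol y_n$ to the components in $\mathfrak u$, put $E(\mathcal P,\mathfrak u)=\sum_{\boldsymbol k_{\mathfrak u}\in\{1,\ldots,2^m-1\}^{|\mathfrak u|}}2^{-\mu(\boldsymbol k_{\mathfrak u})}\left|\frac1{2^m}\sum_{n=0}^{2^m-1}\mathrm{wal}_{\boldsymbol k_{\mathfrak u}}(\boldsymbol y_{n,\mathfrak u})\right|$. For $\boldsymbol g\in G_m^d$, $B_{\boldsymbol\gamma}(\boldsymbol g,f)=\sum_{\emptyset\ne\mathfrak u\subseteq[d]}\gamma_{\mathfrak u}\prod_{i\in\mathfrak u}(b_i-a_i)\,E(\mathcal P(\boldsymbol g,f),\mathfrak u)$. *)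

theory Defs
  imports
    "HOL-Analysis.Analysis"
    "HOL-Library.Z2"
    "HOL-Library.Log_Nat"
    "HOL-Library.Multiset"
    "HOL-Computational_Algebra.Formal_Laurent_Series"
begin

text \<open>
  Conventions. A point of \<open>\<real>\<^sup>d\<close> is an extensional function on the index set \<open>{1..d}\<close>, so that
  products of intervals are \<open>Pi\<^sub>E {1..d} \<dots>\<close>. A point set in which points are counted with
  multiplicity is a multiset of such points. The field of two elements is the type \<^typ>\<open>bit\<close>.
\<close>


subsection \<open>Densities and distribution functions\<close>

definition prob_density_on :: "real \<Rightarrow> real \<Rightarrow> (real \<Rightarrow> real) \<Rightarrow> bool" where
  "prob_density_on l r \<phi> \<longleftrightarrow>
     (\<forall>x\<in>{l..r}. 0 \<le> \<phi> x) \<and> set_integrable lebesgue {l..r} \<phi> \<and> (LINT x:{l..r}|lebesgue. \<phi> x) = 1"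

definition cdf_on :: "real \<Rightarrow> (real \<Rightarrow> real) \<Rightarrow> real \<Rightarrow> real" where
  "cdf_on l \<phi> x = (LINT y:{l..x}|lebesgue. \<phi> y)"

definition cuboid :: "nat \<Rightarrow> (nat \<Rightarrow> real) \<Rightarrow> (nat \<Rightarrow> real) \<Rightarrow> (nat \<Rightarrow> real) set" where
  "cuboid d a b = Pi\<^sub>E {1..d} (\<lambda>i. {a i..b i})"

definition inv_cdf ::
  "nat \<Rightarrow> (nat \<Rightarrow> real) \<Rightarrow> (nat \<Rightarrow> real) \<Rightarrow> (nat \<Rightarrow> real \<Rightarrow> real) \<Rightarrow> (nat \<Rightarrow> real) \<Rightarrow> nat \<Rightarrow> real" where
  "inv_cdf d a b \<phi> y = (\<lambda>i\<in>{1..d}. the_inv_into {a i..b i} (cdf_on (a i) (\<phi> i)) (y i))"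


subsection \<open>Mixed partial derivatives, norm and worst-case error\<close>

text \<open>
  Derivatives are taken within the closed intervals, hence are one-sided on the faces of the cuboid.
  As in \<open>\<partial>\<^sup>k F / (\<partial>x\<^bsub>u\<^sub>1\<^esub> \<dots> \<partial>x\<^bsub>u\<^sub>k\<^esub>)\<close>, the derivative with respect to the last variable is taken first.
\<close>

primrec iter_partial ::
  "(nat \<Rightarrow> real) \<Rightarrow> (nat \<Rightarrow> real) \<Rightarrow> nat list \<Rightarrow> ((nat \<Rightarrow> real) \<Rightarrow> real) \<Rightarrow> (nat \<Rightarrow> real) \<Rightarrow> real" where
  "iter_partial a b [] F = F"
| "iter_partial a b (i # is) F =
     (\<lambda>x. vector_derivative (\<lambda>t. iter_partial a b is F (x(i := t))) (at (x i) within {a i..b i}))"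

primrec iter_partial_exists ::
  "nat \<Rightarrow> (nat \<Rightarrow> real) \<Rightarrow> (nat \<Rightarrow> real) \<Rightarrow> nat list \<Rightarrow> ((nat \<Rightarrow> real) \<Rightarrow> real) \<Rightarrow> bool" where
  "iter_partial_exists d a b [] F \<longleftrightarrow> True"
| "iter_partial_exists d a b (i # is) F \<longleftrightarrow>
     iter_partial_exists d a b is F \<and>
     (\<forall>x\<in>cuboid d a b. (\<lambda>t. iter_partial a b is F (x(i := t))) differentiable
        (at (x i) within {a i..b i}))"

definition mixed_partial ::
  "(nat \<Rightarrow> real) \<Rightarrow> (nat \<Rightarrow> real) \<Rightarrow> nat set \<Rightarrow> ((nat \<Rightarrow> real) \<Rightarrow> real) \<Rightarrow> (nat \<Rightarrow> real) \<Rightarrow> real" where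
  "mixed_partial a b u F = iter_partial a b (sorted_list_of_set u) F"

definition has_mixed_partials ::
  "nat \<Rightarrow> (nat \<Rightarrow> real) \<Rightarrow> (nat \<Rightarrow> real) \<Rightarrow> ((nat \<Rightarrow> real) \<Rightarrow> real) \<Rightarrow> bool" where
  "has_mixed_partials d a b F \<longleftrightarrow>
     (\<forall>u\<in>Pow {1..d}. iter_partial_exists d a b (sorted_list_of_set u) F)"

text \<open>The norm and the worst-case error are extended reals: an unbounded supremum is \<open>\<infinity>\<close>.\<close>

definition mixed_norm ::
  "nat \<Rightarrow> (nat \<Rightarrow> real) \<Rightarrow> (nat \<Rightarrow> real) \<Rightarrow> (nat set \<Rightarrow> real) \<Rightarrow> ((nat \<Rightarrow> real) \<Rightarrow> real) \<Rightarrow> ereal" where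
  "mixed_norm d a b \<gamma> F =
     (MAX u\<in>Pow {1..d}. ereal (1 / \<gamma> u) * (SUP x\<in>cuboid d a b. ereal \<bar>mixed_partial a b u F x\<bar>))"

text \<open>
  The product of \<open>d\<close> copies of one-dimensional Lebesgue measure differs from \<open>d\<close>-dimensional Lebesgue
  measure only by completion. This does not affect the integral below: functions of finite
  norm are continuous on the cuboid, so the integrand is measurable for the product.
\<close>

definition wce ::
  "(nat \<Rightarrow> real) multiset \<Rightarrow> nat \<Rightarrow> (nat \<Rightarrow> real) \<Rightarrow> (nat \<Rightarrow> real) \<Rightarrow> (nat set \<Rightarrow> real)
     \<Rightarrow> (nat \<Rightarrow> real \<Rightarrow> real) \<Rightarrow> ereal" where
  "wce P d a b \<gamma> \<phi> =
     (SUP F\<in>{F. has_mixed_partials d a b F \<and> mixed_norm d a b \<gamma> F \<le> 1}.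
        ereal \<bar>1 / real (size P) * (\<Sum>y\<in>#P. F (inv_cdf d a b \<phi> y))
               - (LINT x:cuboid d a b|Pi\<^sub>M {1..d} (\<lambda>_. lebesgue). F x * (\<Prod>i=1..d. \<phi> i (x i)))\<bar>)"


subsection \<open>Polynomial lattice point sets\<close>

definition polys_below :: "nat \<Rightarrow> bit poly set" where
  "polys_below m = {h. h = 0 \<or> degree h < m}"

text \<open>
  In \<^typ>\<open>bit fls\<close> the formal variable stands for \<open>x\<^sup>-\<^sup>1\<close>; thus \<open>x\<close> is \<^const>\<open>fls_X_inv\<close>, and the
  coefficient of \<open>x\<^sup>-\<^sup>k\<close> of \<open>g\<close> is \<open>fls_nth g k\<close>.
\<close>

definition laurent_of_poly :: "bit poly \<Rightarrow> bit fls" where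
  "laurent_of_poly p = poly (map_poly fls_const p) fls_X_inv"

definition trunc_frac :: "nat \<Rightarrow> bit fls \<Rightarrow> real" where
  "trunc_frac m g = (\<Sum>k=1..m. of_bool (fls_nth g (int k) = 1) / 2 ^ k)"

definition poly_lattice :: "nat \<Rightarrow> (nat \<Rightarrow> bit poly) \<Rightarrow> bit poly \<Rightarrow> (nat \<Rightarrow> real) multiset" where
  "poly_lattice d g f =
     image_mset
       (\<lambda>h. \<lambda>i\<in>{1..d}. trunc_frac (degree f) (laurent_of_poly (h * g i) / laurent_of_poly f))
       (mset_set (polys_below (degree f)))"


subsection \<open>Walsh functions and the figure of merit\<close>

definition dyadic_digit :: "real \<Rightarrow> nat \<Rightarrow> nat" where
  "dyadic_digit x j = nat (\<lfloor>2 ^ j * x\<rfloor> mod 2)"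

text \<open>For \<open>x \<in> [0,1)\<close> these digits form the dyadic expansion with infinitely many digits \<open>\<noteq> 1\<close>.\<close>

lemma sum_dyadic_digit:
  assumes "0 \<le> x" "x < 1"
  shows "(\<Sum>j=1..n. real (dyadic_digit x j) / 2 ^ j) = real_of_int \<lfloor>2 ^ n * x\<rfloor> / 2 ^ n"
proof (induction n)
  case 0
  have "\<lfloor>x\<rfloor> = 0" using assms by linarith
  then show ?case by simp
next
  case (Suc n)
  define y where "y = 2 ^ n * x"
  have "\<lfloor>2 * y\<rfloor> div 2 = \<lfloor>y\<rfloor>"
    using floor_divide_real_eq_div[of 2 "2 * y"] by simp
  then have "2 * \<lfloor>y\<rfloor> + \<lfloor>2 * y\<rfloor> mod 2 = \<lfloor>2 * y\<rfloor>"
    by (metis mult_div_mod_eq)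
  then have "real_of_int (2 * \<lfloor>y\<rfloor> + \<lfloor>2 * y\<rfloor> mod 2) = real_of_int \<lfloor>2 * y\<rfloor>"
    by (rule arg_cong)
  then have "real_of_int \<lfloor>y\<rfloor> / 2 ^ n + real_of_int (\<lfloor>2 * y\<rfloor> mod 2) / 2 ^ Suc n
           = real_of_int \<lfloor>2 * y\<rfloor> / 2 ^ Suc n"
    by (simp add: field_simps)
  then show ?case
    using Suc by (simp add: dyadic_digit_def y_def mult.assoc)
qed

lemma dyadic_digit_expansion:
  assumes "0 \<le> x" "x < 1"
  shows "dyadic_digit x j \<in> {0, 1}"
    and "(\<lambda>j. real (dyadic_digit x (Suc j)) / 2 ^ Suc j) sums x"
    and "infinite {j. dyadic_digit x j \<noteq> 1}"
proof -
  show "dyadic_digit x j \<in> {0, 1}"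
    by (auto simp: dyadic_digit_def)
  define S where "S n = (\<Sum>j=1..n. real (dyadic_digit x j) / 2 ^ j)" for n
  have S: "S n = real_of_int \<lfloor>2 ^ n * x\<rfloor> / 2 ^ n" for n
    unfolding S_def by (rule sum_dyadic_digit[OF assms])
  have upper: "S n \<le> x" for n
    unfolding S by (simp add: divide_simps mult.commute)
  have lower: "x - S n < (1 / 2) ^ n" for n
  proof -
    have "2 ^ n * x < real_of_int \<lfloor>2 ^ n * x\<rfloor> + 1" by linarith
    then have "x < (real_of_int \<lfloor>2 ^ n * x\<rfloor> + 1) / 2 ^ n"
      by (simp add: pos_less_divide_eq mult.commute)
    then show ?thesis unfolding S by (simp add: add_divide_distrib power_one_over)
  qed
  have "(\<lambda>n. x - S n) \<longlonglongrightarrow> 0"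
    by (rule tendsto_sandwich[where f = "\<lambda>_. 0" and h = "\<lambda>n. (1 / 2) ^ n"])
       (use upper lower in \<open>auto intro!: always_eventually less_imp_le LIMSEQ_power_zero\<close>)
  then have "(\<lambda>n. x - (x - S n)) \<longlonglongrightarrow> x - 0"
    by (intro tendsto_diff tendsto_const)
  then have "S \<longlonglongrightarrow> x" by simp
  moreover have "S = (\<lambda>n. \<Sum>j<n. real (dyadic_digit x (Suc j)) / 2 ^ Suc j)"
    unfolding S_def by (intro ext sum.reindex_bij_witness[where i = Suc and j = "\<lambda>j. j - 1"]) auto
  ultimately show "(\<lambda>j. real (dyadic_digit x (Suc j)) / 2 ^ Suc j) sums x"
    by (simp add: sums_def)
  show "infinite {j. dyadic_digit x j \<noteq> 1}"
  proof
    assume "finite {j. dyadic_digit x j \<noteq> 1}"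
    then obtain N where N: "\<And>j. j > N \<Longrightarrow> dyadic_digit x j = 1"
      by (metis (mono_tags, lifting) finite_nat_set_iff_bounded_le mem_Collect_eq not_less)
    have "S (N + k) = S N + (1 / 2) ^ N - (1 / 2) ^ (N + k)" for k
    proof (induction k)
      case (Suc k)
      have "S (N + Suc k) = S (N + k) + real (dyadic_digit x (Suc (N + k))) / 2 ^ Suc (N + k)"
        by (simp add: S_def)
      also have "\<dots> = S (N + k) + (1 / 2) ^ Suc (N + k)"
        by (simp add: N power_one_over)
      finally show ?case using Suc by simp
    qed simp
    moreover have "(\<lambda>k. S N + (1 / 2) ^ N - (1 / 2) ^ (k + N)) \<longlonglongrightarrow> S N + (1 / 2) ^ N - 0"
      by (intro tendsto_diff tendsto_const LIMSEQ_ignore_initial_segment LIMSEQ_power_zero) auto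
    ultimately have "(\<lambda>k. S (k + N)) \<longlonglongrightarrow> S N + (1 / 2) ^ N"
      by (simp add: add.commute)
    moreover have "(\<lambda>k. S (k + N)) \<longlonglongrightarrow> x"
      using \<open>S \<longlonglongrightarrow> x\<close> by (rule LIMSEQ_ignore_initial_segment)
    ultimately have "x = S N + (1 / 2) ^ N"
      by (metis LIMSEQ_unique)
    with lower[of N] show False by simp
  qed
qed

text \<open>
  \<open>floorlog 2 0 = 0\<close>, and \<open>2 ^ (floorlog 2 k - 1) \<le> k < 2 ^ floorlog 2 k\<close> for \<open>k > 0\<close>
  (\<open>floorlog_bounds\<close>). So \<open>dyadic_mu k\<close> is also the number of binary digits of \<open>k\<close>.
\<close>

definition dyadic_mu :: "nat \<Rightarrow> nat" where
  "dyadic_mu k = floorlog 2 k"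

definition walsh :: "nat \<Rightarrow> real \<Rightarrow> real" where
  "walsh k x = (-1) ^ (\<Sum>j<dyadic_mu k. (k div 2 ^ j mod 2) * dyadic_digit x (Suc j))"

definition walsh_sum :: "nat \<Rightarrow> (nat \<Rightarrow> real) multiset \<Rightarrow> nat set \<Rightarrow> real" where
  "walsh_sum m P u =
     (\<Sum>k\<in>Pi\<^sub>E u (\<lambda>_. {1..2 ^ m - 1}).
        (1 / 2 ^ (\<Sum>i\<in>u. dyadic_mu (k i))) * \<bar>1 / 2 ^ m * (\<Sum>y\<in>#P. \<Prod>i\<in>u. walsh (k i) (y i))\<bar>)"

definition merit ::
  "(nat \<Rightarrow> real) \<Rightarrow> (nat \<Rightarrow> real) \<Rightarrow> (nat set \<Rightarrow> real) \<Rightarrow> nat \<Rightarrow> (nat \<Rightarrow> bit poly) \<Rightarrow> bit poly \<Rightarrow> real" where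
  "merit a b \<gamma> d g f =
     (\<Sum>u\<in>Pow {1..d} - {{}}.
        \<gamma> u * (\<Prod>i\<in>u. b i - a i) * walsh_sum (degree f) (poly_lattice d g f) u)"

definition cbc_constructed ::
  "(nat \<Rightarrow> real) \<Rightarrow> (nat \<Rightarrow> real) \<Rightarrow> (nat set \<Rightarrow> real) \<Rightarrow> nat \<Rightarrow> bit poly \<Rightarrow> (nat \<Rightarrow> bit poly) \<Rightarrow> bool" where
  "cbc_constructed a b \<gamma> s f g \<longleftrightarrow>
     g 1 = 1 \<and>
     (\<forall>d\<in>{2..s}.
        is_arg_min (\<lambda>h. merit a b \<gamma> d (g(d := h)) f) (\<lambda>h. h \<in> polys_below (degree f)) (g d))"

end

theory Submission
  imports Defs "HOL-Computational_Algebra.Polynomial_Factorial"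
begin

text \<open>
  All points lie on the grid with spacing \<open>2\<^sup>-\<^sup>m\<close>, so the error splits into the difference between
  the lattice rule and the average over the whole grid, and the difference between that average and
  the integral. The latter is at most \<open>2\<^sup>-\<^sup>m \<Sum>\<^sub>i \<gamma>\<^bsub>{i}\<^esub> (b\<^sub>i - a\<^sub>i)\<close>, since each grid cell has mass
  \<open>2\<^sup>-\<^sup>m\<^sup>d\<close> and the integrand is Lipschitz in each coordinate. For the former, expand the integrand on
  the grid in the finitely many Walsh functions with indices below \<open>2\<^sup>m\<close>. The mean value theorem,
  applied to one coordinate of \<open>u\<close> after the other, bounds the coefficient with support \<open>u\<close> and index
  \<open>k\<close> by \<open>\<gamma>\<^sub>u (\<Prod>\<^bsub>i\<in>u\<^esub> (b\<^sub>i - a\<^sub>i)) 2\<^bsup>-\<mu>(k)\<^esup>\<close>, which gives exactly the figure of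
  merit \<open>B\<^sub>\<gamma>\<close>. Finally, a Walsh sum over the lattice is \<open>0\<close> unless \<open>f\<close> divides \<open>\<Sum>\<^sub>i k\<^sub>i(x) g\<^sub>i\<close>. As \<open>f\<close> is irreducible, for given \<open>k\<close> with \<open>k\<^sub>d \<noteq> 0\<close> at most one of the
  \<open>2\<^sup>m\<close> candidates for \<open>g\<^sub>d\<close> has this property, so averaging over the candidates bounds the minimum.
\<close>


subsection \<open>Binary digits and Walsh functions\<close>

lemma less_power_dyadic_mu: "k < 2 ^ dyadic_mu k"
  using floorlog_bounds[of k 2] by (cases "k = 0") (auto simp: dyadic_mu_def floorlog_def)

lemma dyadic_mu_le:
  assumes "k < 2 ^ M" shows "dyadic_mu k \<le> M"
  using assms by (auto simp: dyadic_mu_def intro!: floorlog_leI)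

lemma nat_div_power_mod_2: "k div 2 ^ j mod 2 = (of_bool (bit k j) :: nat)" for k :: nat
  by (simp add: bit_iff_odd mod_2_eq_odd)

lemma not_bit_if_less:
  fixes k :: nat assumes "k < 2 ^ M" "M \<le> j" shows "\<not> bit k j"
proof -
  have "(2::nat) ^ M \<le> 2 ^ j" using assms(2) by (rule power_increasing) simp
  then have "k div 2 ^ j = 0" using assms(1) by (intro div_less) linarith
  then show ?thesis by (simp add: bit_iff_odd)
qed

text \<open>The exponent in \<open>walsh\<close> stops at the length of \<open>k\<close>. Padding
  with zero bits up to a common length \<open>M\<close> gives one product formula for all indices
  below \<open>2 ^ M\<close>.\<close>

lemma walsh_eq_prod:
  assumes "k < 2 ^ M"
  shows "walsh k x = (\<Prod>j<M. if bit k j \<and> odd (dyadic_digit x (Suc j)) then -1 else 1)"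
proof -
  have "walsh k x = (\<Prod>j<dyadic_mu k. (-1) ^ (of_bool (bit k j) * dyadic_digit x (Suc j)))"
    by (simp only: walsh_def power_sum nat_div_power_mod_2)
  also have "\<dots> = (\<Prod>j<M. (-1) ^ (of_bool (bit k j) * dyadic_digit x (Suc j)))"
  proof (rule prod.mono_neutral_left)
    show "\<forall>j\<in>{..<M} - {..<dyadic_mu k}. (-1::real) ^ (of_bool (bit k j) * dyadic_digit x (Suc j)) = 1"
    proof
      fix j assume "j \<in> {..<M} - {..<dyadic_mu k}"
      then show "(-1::real) ^ (of_bool (bit k j) * dyadic_digit x (Suc j)) = 1"
        using not_bit_if_less[OF less_power_dyadic_mu, of k j] by simp
    qed
  qed (use dyadic_mu_le[OF assms] in auto)
  also have "\<dots> = (\<Prod>j<M. if bit k j \<and> odd (dyadic_digit x (Suc j)) then -1 else 1)"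
    by (intro prod.cong) auto
  finally show ?thesis .
qed

text \<open>Digits after the point are counted from the most significant end, bits of a natural
  number from the least significant one; hence the reversal \<open>m - j\<close>.\<close>

lemma dyadic_digit_grid:
  assumes "j \<le> m"
  shows "dyadic_digit (real n / 2 ^ m) j = of_bool (bit n (m - j))"
proof -
  have "2 ^ j * (real n / 2 ^ m) = real n / real (2 ^ (m - j))"
    unfolding of_nat_power using assms by (simp add: power_diff[of "2::real"] field_simps)
  then have "\<lfloor>2 ^ j * (real n / 2 ^ m)\<rfloor> = int (n div 2 ^ (m - j))"
    by (simp only: floor_divide_of_nat_eq)
  then have "dyadic_digit (real n / 2 ^ m) j = n div 2 ^ (m - j) mod 2"
    unfolding dyadic_digit_def
    by (metis nat_int of_nat_mod of_nat_numeral)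
  then show ?thesis by (simp add: nat_div_power_mod_2)
qed

lemma walsh_grid_eq_prod:
  assumes "k < 2 ^ m"
  shows "walsh k (real n / 2 ^ m) = (\<Prod>j<m. if bit k j \<and> bit n (m - Suc j) then -1 else 1)"
  unfolding walsh_eq_prod[OF assms] by (intro prod.cong) (auto simp: dyadic_digit_grid)


subsection \<open>Laurent series\<close>

lemma laurent_of_poly_0 [simp]: "laurent_of_poly 0 = 0"
  by (simp add: laurent_of_poly_def)

lemma laurent_of_poly_pCons:
  "laurent_of_poly (pCons c p) = fls_const c + fls_X_inv * laurent_of_poly p"
  by (simp add: laurent_of_poly_def map_poly_pCons)

lemma laurent_of_poly_nth:
  "fls_nth (laurent_of_poly p) n = (if n \<le> 0 then coeff p (nat (- n)) else 0)"
proof (induction p arbitrary: n)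
  case (pCons c p)
  have "nat (- n) = Suc (nat (- (n + 1)))" if "n < 0" using that by simp
  then show ?case
    using pCons by (auto simp: laurent_of_poly_pCons fls_X_inv_times_conv_shift)
qed simp

lemma laurent_of_poly_add: "laurent_of_poly (p + q) = laurent_of_poly p + laurent_of_poly q"
  by (intro fls_eqI) (simp add: laurent_of_poly_nth)

lemma laurent_of_poly_smult: "laurent_of_poly (smult c p) = fls_const c * laurent_of_poly p"
  by (intro fls_eqI) (simp add: laurent_of_poly_nth)

lemma laurent_of_poly_mult: "laurent_of_poly (p * q) = laurent_of_poly p * laurent_of_poly q"
  by (induction p)
     (simp_all add: laurent_of_poly_pCons laurent_of_poly_add laurent_of_poly_smult ring_distribs
        mult.assoc)

lemma laurent_of_poly_sum: "laurent_of_poly (sum p A) = (\<Sum>i\<in>A. laurent_of_poly (p i))"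
  by (induction A rule: infinite_finite_induct) (simp_all add: laurent_of_poly_add)

lemma laurent_of_poly_monom: "laurent_of_poly (monom c n) = fls_const c * fls_X_inv ^ n"
  by (intro fls_eqI) (auto simp: laurent_of_poly_nth)

lemma laurent_of_poly_eq_0_iff [simp]: "laurent_of_poly p = 0 \<longleftrightarrow> p = 0"
proof
  assume L: "laurent_of_poly p = 0"
  show "p = 0"
  proof (intro poly_eqI)
    fix n show "coeff p n = coeff 0 n"
      using laurent_of_poly_nth[of p "- int n"] L by simp
  qed
qed simp

lemma fls_subdegree_laurent_of_poly:
  "p \<noteq> 0 \<Longrightarrow> fls_subdegree (laurent_of_poly p) = - int (degree p)"
  by (intro fls_subdegree_eqI) (auto simp: laurent_of_poly_nth coeff_eq_0)


subsection \<open>Walsh functions as characters\<close>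

text \<open>The nontrivial additive character of the field with two elements.\<close>

definition bit_sign :: "bit \<Rightarrow> real" where
  "bit_sign c = (if c = 1 then -1 else 1)"

lemma bit_sign_0 [simp]: "bit_sign 0 = 1" and bit_sign_1 [simp]: "bit_sign 1 = -1"
  by (simp_all add: bit_sign_def)

lemma bit_sign_add: "bit_sign (x + y) = bit_sign x * bit_sign y"
  by (cases x; cases y) simp_all

lemma bit_sign_sum: "bit_sign (sum c A) = (\<Prod>i\<in>A. bit_sign (c i))"
  by (induction A rule: infinite_finite_induct)
     (simp_all add: bit_sign_add del: add_bit_eq_xor)

text \<open>The numerator of \<open>trunc_frac m G\<close> over \<open>2 ^ m\<close>, which turns
  lattice points into grid indices. The list starts with the least significant bit, that is, with
  the coefficient of x^-m.\<close>

definition trunc_num :: "nat \<Rightarrow> bit fls \<Rightarrow> nat" where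
  "trunc_num m G = horner_sum of_bool 2 (map (\<lambda>i. fls_nth G (int (m - i)) = 1) [0..<m])"

lemma trunc_num_less: "trunc_num m G < 2 ^ m"
  using horner_sum_of_bool_2_less[of "map (\<lambda>i. fls_nth G (int (m - i)) = 1) [0..<m]", where 'a = nat]
  by (simp add: trunc_num_def)

lemma trunc_frac_eq: "trunc_frac m G = real (trunc_num m G) / 2 ^ m"
proof -
  have "real (trunc_num m G) = (\<Sum>i<m. of_bool (fls_nth G (int (m - i)) = 1) * 2 ^ i)"
    unfolding trunc_num_def horner_sum_eq_sum of_nat_sum by (intro sum.cong) auto
  also have "\<dots> / 2 ^ m = (\<Sum>i<m. of_bool (fls_nth G (int (m - i)) = 1) / 2 ^ (m - i))"
    unfolding sum_divide_distrib by (intro sum.cong refl) (simp add: power_diff)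
  also have "\<dots> = trunc_frac m G"
    unfolding trunc_frac_def
    by (rule sum.reindex_bij_witness[where i = "\<lambda>k. m - k" and j = "\<lambda>k. m - k"]) auto
  finally show ?thesis by simp
qed

text \<open>The usual polynomial k(x) attached to a Walsh index; with it, membership in the dual
  lattice becomes a divisibility condition.\<close>

definition bin_poly :: "nat \<Rightarrow> bit poly" where
  "bin_poly k = (\<Sum>j<dyadic_mu k. monom (of_bool (bit k j)) j)"

lemma coeff_bin_poly: "coeff (bin_poly k) j = of_bool (bit k j)"
proof (cases "j < dyadic_mu k")
  case False
  then show ?thesis
    using not_bit_if_less[OF less_power_dyadic_mu, of k j] by (simp add: bin_poly_def coeff_sum)
qed (simp add: bin_poly_def coeff_sum)

lemma bin_poly_eq_sum:
  assumes "k < 2 ^ m" shows "bin_poly k = (\<Sum>j<m. monom (of_bool (bit k j)) j)"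
proof (rule poly_eqI)
  fix j
  have "\<not> bit k j" if "\<not> j < m"
    using not_bit_if_less[OF assms, of j] that by simp
  then show "coeff (bin_poly k) j = coeff (\<Sum>j<m. monom (of_bool (bit k j)) j) j"
    by (auto simp: coeff_bin_poly coeff_sum)
qed

lemma bin_poly_eq_0_iff [simp]: "bin_poly k = 0 \<longleftrightarrow> k = 0"
proof
  assume "bin_poly k = 0"
  then have "\<not> bit k j" for j using coeff_bin_poly[of k j] by simp
  then show "k = 0" by (simp add: bit_eq_iff)
qed (simp add: bin_poly_def dyadic_mu_def floorlog_def)

lemma degree_bin_poly:
  assumes "k < 2 ^ m" "k \<noteq> 0" shows "degree (bin_poly k) < m"
proof -
  have "m \<noteq> 0" using assms by (cases m) auto
  moreover have "degree (bin_poly k) \<le> m - 1"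
    unfolding bin_poly_eq_sum[OF assms(1)]
    by (intro degree_sum_le) (auto intro: order.trans[OF degree_monom_le])
  ultimately show ?thesis by linarith
qed

text \<open>Multiplication by \<open>fls_X_inv ^ j\<close> moves the coefficient at
  \<open>j + 1\<close> to index 1. The coefficient of x^-1 therefore pairs bit \<open>j\<close> of
  \<open>k\<close> with digit \<open>j + 1\<close>, exactly as the Walsh exponent does.\<close>

lemma walsh_trunc_frac:
  assumes "k < 2 ^ m"
  shows "walsh k (trunc_frac m G) = bit_sign (fls_nth (laurent_of_poly (bin_poly k) * G) 1)"
proof -
  \<comment> \<open>The reversals in \<open>trunc_num\<close> and in
    \<open>walsh_grid_eq_prod\<close> cancel.\<close>
  have bit: "bit (trunc_num m G) (m - Suc j) \<longleftrightarrow> fls_nth G (int j + 1) = 1" if "j < m" for j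
    using that by (simp add: trunc_num_def bit_horner_sum_bit_iff of_nat_diff add.commute)
  have "fls_nth (laurent_of_poly (bin_poly k) * G) 1
      = (\<Sum>j<m. of_bool (bit k j) * fls_nth G (int j + 1))"
    unfolding bin_poly_eq_sum[OF assms] laurent_of_poly_sum laurent_of_poly_monom sum_distrib_right
      fls_nth_sum mult.assoc fls_X_inv_power_times_conv_shift(1)
    by (simp add: add.commute)
  also have "bit_sign \<dots> = (\<Prod>j<m. if bit k j \<and> fls_nth G (int j + 1) = 1 then -1 else 1)"
    unfolding bit_sign_sum by (intro prod.cong refl) (simp add: bit_sign_def)
  also have "\<dots> = walsh k (trunc_frac m G)"
    unfolding trunc_frac_eq walsh_grid_eq_prod[OF assms] by (intro prod.cong refl) (simp add: bit)
  finally show ?thesis by simp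
qed


subsection \<open>Dual lattice\<close>

lemma polys_below_Suc: "polys_below (Suc m) = (\<lambda>(c, p). pCons c p) ` (UNIV \<times> polys_below m)"
proof -
  have "p \<in> (\<lambda>(c, p). pCons c p) ` (UNIV \<times> polys_below m)" if "p \<in> polys_below (Suc m)" for p
    using that by (cases p) (force simp: polys_below_def split: if_splits)
  then show ?thesis by (auto simp: polys_below_def degree_pCons_eq_if split: if_splits)
qed

lemma finite_polys_below: "finite (polys_below m)"
  and card_polys_below: "card (polys_below m) = 2 ^ m"
proof (induction m)
  case 0
  { case 1 show ?case by (simp add: polys_below_def) }
  { case 2 show ?case by (simp add: polys_below_def) }
next
  case (Suc m)
  have UNIV_bit: "(UNIV :: bit set) = {0, 1}"
    using bit.exhaust by blast
  have "inj_on (\<lambda>(c, p). pCons c p) (UNIV \<times> polys_below m)"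
    by (auto intro!: inj_onI)
  { case 1 show ?case using Suc by (simp add: polys_below_Suc UNIV_bit) }
  { case 2 show ?case using Suc
      by (simp add: polys_below_Suc card_image[OF \<open>inj_on _ _\<close>] card_cartesian_product)
         (simp add: UNIV_bit) }
qed

lemma polys_below_add:
  "p \<in> polys_below m \<Longrightarrow> q \<in> polys_below m \<Longrightarrow> p + q \<in> polys_below m"
  by (auto simp: polys_below_def intro: degree_add_less)

text \<open>If \<open>f\<close> does not divide \<open>K\<close>, then translation by some \<open>h\<^sub>0\<close> changes the sign of the sum.\<close>

lemma sum_character:
  fixes f K :: "bit poly"
  assumes f: "f \<noteq> 0" and m: "degree f = m"
  shows "(\<Sum>h\<in>polys_below m. bit_sign (fls_nth (laurent_of_poly (h * K) / laurent_of_poly f) 1))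
       = 2 ^ m * of_bool (f dvd K)"
proof (cases "f dvd K")
  case True
  then obtain q where q: "K = f * q" by blast
  have "laurent_of_poly (h * K) / laurent_of_poly f = laurent_of_poly (h * q)" for h
    using f by (simp add: q laurent_of_poly_mult)
  then have "bit_sign (fls_nth (laurent_of_poly (h * K) / laurent_of_poly f) 1) = 1" for h
    by (simp add: laurent_of_poly_nth)
  then show ?thesis using True by (simp add: card_polys_below)
next
  case False
  define \<psi> where "\<psi> h = bit_sign (fls_nth (laurent_of_poly (h * K) / laurent_of_poly f) 1)" for h
  have add: "\<psi> (h + h') = \<psi> h * \<psi> h'" for h h'
    by (simp add: \<psi>_def ring_distribs laurent_of_poly_add add_divide_distrib bit_sign_add
        del: add_bit_eq_xor)
  \<comment> \<open>Only the remainder matters: the quotient contributes a polynomial, which has no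
    coefficient at x^-1.\<close>
  define r where "r = K mod f"
  have r: "r \<noteq> 0" using False by (simp add: r_def dvd_eq_mod_eq_0)
  have K: "K = f * (K div f) + r" by (simp add: r_def)
  have r_div: "laurent_of_poly (h * K) / laurent_of_poly f
             = laurent_of_poly (h * (K div f)) + laurent_of_poly (h * r) / laurent_of_poly f" for h
    using f by (subst K) (simp add: laurent_of_poly_add laurent_of_poly_mult ring_distribs
      add_divide_distrib)
  have deg: "degree r < m" using f m r degree_mod_less[of f K] by (auto simp: r_def)
  \<comment> \<open>The exponent for which \<open>h0 * r\<close> has degree \<open>m - 1\<close>, so
    that the leading term of \<open>h0 * r / f\<close> is x^-1.\<close>
  define t where "t = m - 1 - degree r"
  define h0 :: "bit poly" where "h0 = monom 1 t"
  have h0: "h0 \<in> polys_below m" using deg by (auto simp: h0_def polys_below_def t_def degree_monom_eq)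
  have ne: "laurent_of_poly (h0 * r) / laurent_of_poly f \<noteq> 0"
    using f r by (simp add: h0_def)
  have "h0 \<noteq> 0" by (simp add: h0_def)
  have "fls_subdegree (laurent_of_poly (h0 * r) / laurent_of_poly f) = - int (t + degree r) + int m"
    using f r m \<open>h0 \<noteq> 0\<close>
    by (simp add: fls_divide_subdegree fls_subdegree_laurent_of_poly degree_mult_eq)
       (simp add: h0_def degree_monom_eq)
  also have "\<dots> = 1" using deg by (simp add: t_def)
  finally have "fls_nth (laurent_of_poly (h0 * r) / laurent_of_poly f) 1 \<noteq> 0"
    using nth_fls_subdegree_nonzero[OF ne] by simp
  then have \<psi>0: "\<psi> h0 = -1"
    by (simp add: \<psi>_def r_div laurent_of_poly_nth)
  \<comment> \<open>In characteristic two, translation by \<open>h0\<close> is its own inverse,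
    hence a permutation of \<open>polys_below m\<close>.\<close>
  have "c + c = 0" for c :: bit by (cases c) simp_all
  then have "h0 + h0 = 0" by (intro poly_eqI) (simp only: coeff_add coeff_0)
  then have [simp]: "h + h0 + h0 = h" for h by (simp only: add.assoc add_0_right)
  have "(\<Sum>h\<in>polys_below m. \<psi> h) = (\<Sum>h\<in>polys_below m. \<psi> (h + h0))"
    by (rule sum.reindex_bij_witness[where i = "\<lambda>h. h + h0" and j = "\<lambda>h. h + h0"])
       (simp_all add: polys_below_add h0)
  also have "\<dots> = - (\<Sum>h\<in>polys_below m. \<psi> h)"
    by (simp add: add \<psi>0 sum_negf)
  finally show ?thesis using False by (simp add: \<psi>_def)
qed

text \<open>Additivity of the character merges all coordinates into the single polynomial \<Sum>
  k_i(x) g_i, which alone decides the Walsh sum.\<close>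

lemma prod_walsh_lattice:
  assumes "finite u" "\<And>i. i \<in> u \<Longrightarrow> k i < 2 ^ m"
  shows "(\<Prod>i\<in>u. walsh (k i) (trunc_frac m (laurent_of_poly (h * g i) / laurent_of_poly f)))
       = bit_sign (fls_nth (laurent_of_poly (h * (\<Sum>i\<in>u. bin_poly (k i) * g i)) / laurent_of_poly f) 1)"
proof -
  have "laurent_of_poly (h * (\<Sum>i\<in>u. bin_poly (k i) * g i)) / laurent_of_poly f
      = (\<Sum>i\<in>u. laurent_of_poly (bin_poly (k i)) * (laurent_of_poly (h * g i) / laurent_of_poly f))"
    by (simp add: sum_distrib_left sum_divide_distrib laurent_of_poly_sum laurent_of_poly_mult
        mult_ac)
  then show ?thesis using assms by (simp add: walsh_trunc_frac fls_nth_sum bit_sign_sum)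
qed

lemma sum_mset_poly_lattice:
  "(\<Sum>y\<in>#poly_lattice d g f. F y) =
     (\<Sum>h\<in>polys_below (degree f).
        F (\<lambda>i\<in>{1..d}. trunc_frac (degree f) (laurent_of_poly (h * g i) / laurent_of_poly f)))"
  by (simp add: poly_lattice_def sum_unfold_sum_mset multiset.map_comp comp_def)

text \<open>By \<open>sum_character\<close> the inner mean is 0 or 1, so the absolute value
  disappears and a weighted count of dual vectors remains.\<close>

lemma walsh_sum_poly_lattice:
  assumes f: "f \<noteq> 0" "degree f = m" and u: "u \<subseteq> {1..d}"
  shows "walsh_sum m (poly_lattice d g f) u =
    (\<Sum>k\<in>Pi\<^sub>E u (\<lambda>_. {1..2 ^ m - 1}).
       1 / 2 ^ (\<Sum>i\<in>u. dyadic_mu (k i)) * of_bool (f dvd (\<Sum>i\<in>u. bin_poly (k i) * g i)))"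
  unfolding walsh_sum_def
proof (intro sum.cong refl arg_cong2[where f = "(*)"])
  fix k assume k: "k \<in> Pi\<^sub>E u (\<lambda>_. {1..2 ^ m - 1 :: nat})"
  have fin: "finite u" using u finite_subset by blast
  have k': "k i < 2 ^ m" if "i \<in> u" for i
  proof -
    have "k i \<le> 2 ^ m - 1" using PiE_mem[OF k that] by simp
    also have "\<dots> < 2 ^ m" by simp
    finally show ?thesis .
  qed
  have "(\<Sum>y\<in>#poly_lattice d g f. \<Prod>i\<in>u. walsh (k i) (y i)) =
      (\<Sum>h\<in>polys_below m. \<Prod>i\<in>u. walsh (k i) (trunc_frac m (laurent_of_poly (h * g i) / laurent_of_poly f)))"
    unfolding sum_mset_poly_lattice f(2) using u by (intro sum.cong prod.cong) auto
  also have "\<dots> = 2 ^ m * of_bool (f dvd (\<Sum>i\<in>u. bin_poly (k i) * g i))"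
    using k' fin by (simp add: prod_walsh_lattice sum_character f)
  finally show "\<bar>1 / 2 ^ m * (\<Sum>y\<in>#poly_lattice d g f. \<Prod>i\<in>u. walsh (k i) (y i))\<bar>
      = of_bool (f dvd (\<Sum>i\<in>u. bin_poly (k i) * g i))" by simp
qed


subsection \<open>Component-by-component construction\<close>

lemma le_power_minus_1_iff: "k \<le> 2 ^ m - 1 \<longleftrightarrow> k < 2 ^ m" for k :: nat
  using less_Suc_eq_le[of k "2 ^ m - 1"] by (simp del: less_Suc_eq_le)

text \<open>There are \<open>2 ^ (l - 1)\<close> indices of bit length l, each of weight
  \<open>1 / 2 ^ l\<close>, so every length contributes one half. The induction splits off the
  indices of maximal length.\<close>

lemma sum_inverse_power_dyadic_mu:
  "(\<Sum>k=1..2 ^ m - 1. 1 / 2 ^ dyadic_mu k :: real) = real m / 2"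
proof (induction m)
  case (Suc m)
  have mu: "dyadic_mu k = Suc m" if "k \<in> {2 ^ m..2 ^ Suc m - 1}" for k
  proof (rule antisym)
    show "dyadic_mu k \<le> Suc m"
      using that by (intro dyadic_mu_le) (simp only: atLeastAtMost_iff le_power_minus_1_iff)
    have "(2::nat) ^ m < 2 ^ dyadic_mu k"
      using that by (intro le_less_trans[OF _ less_power_dyadic_mu]) (simp only: atLeastAtMost_iff)
    then show "Suc m \<le> dyadic_mu k"
      by (simp only: power_strict_increasing_iff[of "2::nat"] Suc_le_eq one_less_numeral_iff semiring_norm)
  qed
  have "2 ^ m - 1 < (2 ^ m :: nat)" "(2::nat) ^ m \<le> 2 ^ Suc m - 1" "1 \<le> (2::nat) ^ m"
    by simp_all
  then have "{1..2 ^ Suc m - 1} = {1..2 ^ m - 1} \<union> {2 ^ m..2 ^ Suc m - 1 :: nat}"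
    unfolding set_eq_iff Un_iff atLeastAtMost_iff by linarith
  then have "(\<Sum>k=1..2 ^ Suc m - 1. 1 / 2 ^ dyadic_mu k :: real)
      = (\<Sum>k=1..2 ^ m - 1. 1 / 2 ^ dyadic_mu k) + (\<Sum>k=2 ^ m..2 ^ Suc m - 1. 1 / 2 ^ dyadic_mu k)"
    by (simp only:) (rule sum.union_disjoint, simp_all add: ivl_disj_int)
  also have "(\<Sum>k=2 ^ m..2 ^ Suc m - 1. 1 / 2 ^ dyadic_mu k :: real)
      = (\<Sum>k\<in>{2 ^ m..2 ^ Suc m - 1 :: nat}. 1 / 2 ^ Suc m)"
    by (intro sum.cong refl) (simp only: mu)
  also have "\<dots> = 1 / 2" by simp
  finally show ?case using Suc by (simp add: field_simps)
qed simp

lemma sum_PiE_inverse_power_dyadic_mu: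
  assumes "finite u"
  shows "(\<Sum>k\<in>Pi\<^sub>E u (\<lambda>_. {1..2 ^ m - 1}). 1 / 2 ^ (\<Sum>i\<in>u. dyadic_mu (k i)) :: real)
       = (real m / 2) ^ card u"
proof -
  have "(real m / 2) ^ card u = (\<Prod>i\<in>u. \<Sum>k=1..2 ^ m - 1. 1 / 2 ^ dyadic_mu k)"
    by (simp only: sum_inverse_power_dyadic_mu prod_constant)
  also have "\<dots> = (\<Sum>k\<in>Pi\<^sub>E u (\<lambda>_. {1..2 ^ m - 1}). \<Prod>i\<in>u. 1 / 2 ^ dyadic_mu (k i))"
    using assms by (rule prod_sum_PiE) simp
  finally show ?thesis by (simp add: power_sum prod_dividef)
qed

text \<open>For two solutions \<open>f\<close> divides \<open>p * (h - h')\<close>. As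
  \<open>f\<close> is prime and both factors have degree below \<open>degree f\<close>, the
  difference must vanish.\<close>

lemma card_dvd_le_1:
  fixes f p q :: "bit poly"
  assumes f: "irreducible f" "degree f = m" and p: "p \<noteq> 0" "degree p < m"
  shows "card {h\<in>polys_below m. f dvd p * h + q} \<le> 1"
proof -
  have "h = h'" if h: "h \<in> polys_below m" "h' \<in> polys_below m"
      and dvd: "f dvd p * h + q" "f dvd p * h' + q" for h h'
  proof (rule ccontr)
    assume "h \<noteq> h'"
    have "f dvd (p * h + q) - (p * h' + q)" using dvd by (rule dvd_diff)
    then have "f dvd p * (h - h')" by (simp add: algebra_simps)
    then have "f dvd p \<or> f dvd h - h'"
      using field_poly_irreducible_imp_prime[OF f(1)] by (simp add: prime_elem_dvd_mult_iff)
    moreover have "\<not> f dvd p"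
      using p f(2) dvd_imp_degree_le[of f p] by auto
    moreover have "degree (h - h') < m"
      using h p(2) by (cases "h = 0"; cases "h' = 0") (auto simp: polys_below_def intro: degree_diff_less)
    then have "\<not> f dvd h - h'"
      using \<open>h \<noteq> h'\<close> f(2) dvd_imp_degree_le[of f "h - h'"] by auto
    ultimately show False by blast
  qed
  then show ?thesis
    by (intro card_le_Suc0_iff_eq[THEN iffD2, simplified One_nat_def[symmetric]])
       (auto simp: finite_polys_below)
qed

text \<open>Exchanging the sums fixes \<open>k\<close> before the candidate \<open>h\<close>. Since
  \<open>d \<in> u\<close>, the entry \<open>k d\<close> is nonzero, so each \<open>k\<close> is
  counted for at most one \<open>h\<close>.\<close>

lemma sum_walsh_sum_le:
  assumes f: "irreducible f" "degree f = m" and u: "u \<subseteq> {1..d}" "d \<in> u"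
  shows "(\<Sum>h\<in>polys_below m. walsh_sum m (poly_lattice d (g(d := h)) f) u)
       \<le> (real m / 2) ^ card u"
proof -
  have fin: "finite u" using u finite_subset by blast
  have f0: "f \<noteq> 0" using f(1) by auto
  define q where "q k = (\<Sum>i\<in>u - {d}. bin_poly (k i) * g i)" for k :: "nat \<Rightarrow> nat"
  have sum_eq: "(\<Sum>i\<in>u. bin_poly (k i) * (g(d := h)) i) = bin_poly (k d) * h + q k" for h k
    using fin u(2) by (simp add: sum.remove q_def)
  have "(\<Sum>h\<in>polys_below m. walsh_sum m (poly_lattice d (g(d := h)) f) u)
      = (\<Sum>k\<in>Pi\<^sub>E u (\<lambda>_. {1..2 ^ m - 1}). \<Sum>h\<in>polys_below m.
           1 / 2 ^ (\<Sum>i\<in>u. dyadic_mu (k i)) * of_bool (f dvd bin_poly (k d) * h + q k))"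
    unfolding walsh_sum_poly_lattice[OF f0 f(2) u(1)] sum_eq by (rule sum.swap)
  also have "\<dots> = (\<Sum>k\<in>Pi\<^sub>E u (\<lambda>_. {1..2 ^ m - 1}).
      1 / 2 ^ (\<Sum>i\<in>u. dyadic_mu (k i)) * real (card {h\<in>polys_below m. f dvd bin_poly (k d) * h + q k}))"
    by (simp add: finite_polys_below Int_def flip: sum_distrib_left sum_divide_distrib)
  also have "\<dots> \<le> (\<Sum>k\<in>Pi\<^sub>E u (\<lambda>_. {1..2 ^ m - 1}). 1 / 2 ^ (\<Sum>i\<in>u. dyadic_mu (k i)) * 1)"
  proof (intro sum_mono mult_left_mono)
    fix k assume "k \<in> Pi\<^sub>E u (\<lambda>_. {1..2 ^ m - 1 :: nat})"
    then have k: "1 \<le> k d" "k d \<le> 2 ^ m - 1" using u(2) by (auto dest: PiE_mem)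
    note k(2)
    also have "2 ^ m - 1 < (2 ^ m :: nat)" by simp
    finally have "degree (bin_poly (k d)) < m" using k(1) by (intro degree_bin_poly) auto
    moreover have "bin_poly (k d) \<noteq> 0" using k(1) by simp
    ultimately show "real (card {h\<in>polys_below m. f dvd bin_poly (k d) * h + q k}) \<le> 1"
      using card_dvd_le_1[OF f, of "bin_poly (k d)" "q k"] by simp
  qed simp
  also have "\<dots> = (real m / 2) ^ card u"
    using sum_PiE_inverse_power_dyadic_mu[OF fin] by simp
  finally show ?thesis .
qed

text \<open>Carries the terms of an earlier dimension over to the next one: only the components in
  \<open>u\<close> matter.\<close>

lemma walsh_sum_poly_lattice_cong:
  assumes "f \<noteq> 0" "u \<subseteq> {1..d}" "u \<subseteq> {1..d'}" "\<And>i. i \<in> u \<Longrightarrow> g i = g' i"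
  shows "walsh_sum (degree f) (poly_lattice d g f) u = walsh_sum (degree f) (poly_lattice d' g' f) u"
  using assms by (simp add: walsh_sum_poly_lattice cong: sum.cong)

section \<open>Figure of merit of the constructed vector\<close>

lemma merit_1:
  assumes f: "f \<noteq> 0" "degree f = m" and g: "g 1 = 1"
  shows "merit a b \<gamma> 1 g f = 0"
proof -
  have Pow: "Pow {1..1} - {{}} = {{1::nat}}"
    unfolding atLeastAtMost_singleton Pow_insert Pow_empty by blast
  have dvd: "\<not> f dvd (\<Sum>i\<in>{1}. bin_poly (k i) * g i)"
    if k: "k \<in> Pi\<^sub>E {1} (\<lambda>_. {1..2 ^ m - 1 :: nat})" for k
  proof -
    have k1: "1 \<le> k 1" "k 1 < 2 ^ m"
      using PiE_mem[OF k, of 1] by (simp_all only: singletonI atLeastAtMost_iff le_power_minus_1_iff)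
    then have "bin_poly (k 1) \<noteq> 0" "degree (bin_poly (k 1)) < m"
      by (simp_all add: degree_bin_poly)
    then have "\<not> f dvd bin_poly (k 1)"
      using dvd_imp_degree_le[of f "bin_poly (k 1)"] f(2) by (meson not_le)
    then show ?thesis
      by (simp only: g mult_1_right sum.insert finite.emptyI empty_iff not_False_eq_True sum.empty
          add_0_right)
  qed
  have "walsh_sum m (poly_lattice 1 g f) {1} = 0"
  proof (subst walsh_sum_poly_lattice[OF f])
    show "(\<Sum>k\<in>Pi\<^sub>E {1} (\<lambda>_. {1..2 ^ m - 1}). 1 / 2 ^ (\<Sum>i\<in>{1}. dyadic_mu (k i)) *
        of_bool (f dvd (\<Sum>i\<in>{1}. bin_poly (k i) * g i))) = (0 :: real)"
      by (intro sum.neutral ballI) (simp only: dvd of_bool_eq mult_zero_right)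
  qed simp
  then show ?thesis
    by (simp only: merit_def Pow f(2) sum.insert finite.emptyI empty_iff not_False_eq_True sum.empty
        mult_zero_right add_0_right)
qed

text \<open>Induction on the dimension. Sets \<open>u\<close> without the new coordinate keep their
  value whatever the candidate is, so averaging concerns only the sets in \<open>new\<close>, and
  the two bounds add up to a sum over all nonempty sets.\<close>

lemma merit_cbc_le:
  assumes f: "irreducible f" "degree f = m"
    and ab: "\<And>i. i \<in> {1..s} \<Longrightarrow> a i < b i"
    and \<gamma>: "\<And>u. u \<subseteq> {1..s} \<Longrightarrow> 0 < \<gamma> u"
    and cbc: "cbc_constructed a b \<gamma> s f g"
    and d: "1 \<le> d" "d \<le> s"
  shows "merit a b \<gamma> d g f
    \<le> 1 / 2 ^ m * (\<Sum>u\<in>Pow {1..d} - {{}}. \<gamma> u * (real m / 2) ^ card u * (\<Prod>i\<in>u. b i - a i))"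
proof -
  have weight: "0 \<le> \<gamma> u * (\<Prod>i\<in>u. b i - a i)" if "u \<subseteq> {1..s}" for u
    using \<gamma>[OF that] ab that by (intro mult_nonneg_nonneg prod_nonneg) (simp_all add: less_imp_le subset_iff)
  show ?thesis using d
  proof (induction d rule: dec_induct)
    case base
    have f0: "f \<noteq> 0" using f(1) by auto
    have "g 1 = 1" using cbc by (simp add: cbc_constructed_def)
    then have "merit a b \<gamma> 1 g f = 0" by (rule merit_1[OF f0 f(2)])
    also have "0 \<le> 1 / 2 ^ m * (\<Sum>u\<in>Pow {1..1} - {{}}. \<gamma> u * (\<Prod>i\<in>u. b i - a i) * (real m / 2) ^ card u)"
    proof (intro mult_nonneg_nonneg[OF _ sum_nonneg] mult_nonneg_nonneg[OF weight])
      fix u assume "u \<in> Pow {1..1} - {{} :: nat set}"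
      then show "u \<subseteq> {1..s}" using base by force
    qed simp_all
    finally show ?case by (simp only: mult_ac)
  next
    case (step n)
    define d where "d = Suc n"
    have d: "d \<in> {2..s}" using step by (simp add: d_def)
    have f0: "f \<noteq> 0" using f(1) by auto
    define c where "c u = \<gamma> u * (\<Prod>i\<in>u. b i - a i)" for u
    have c: "0 \<le> c u" if "u \<subseteq> {1..s}" for u
      unfolding c_def using that by (rule weight)
    define new where "new = {u. u \<subseteq> {1..d} \<and> d \<in> u}"
    have fin: "finite new" by (rule finite_subset[of _ "Pow {1..d}"]) (auto simp: new_def)
    have "{1..d} = insert d {1..n}" by (auto simp: d_def)
    then have split: "Pow {1..d} - {{}} = (Pow {1..n} - {{}}) \<union> new"
      by (auto simp: new_def)
    have disj: "(Pow {1..n} - {{}}) \<inter> new = {}"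
      by (auto simp: new_def d_def)
    have sum_split: "(\<Sum>u\<in>Pow {1..d} - {{}}. F u) = (\<Sum>u\<in>Pow {1..n} - {{}}. F u) + (\<Sum>u\<in>new. F u)"
      for F :: "nat set \<Rightarrow> real"
      unfolding split by (rule sum.union_disjoint) (use fin disj in auto)
    have merit_eq: "merit a b \<gamma> d (g(d := h)) f
        = merit a b \<gamma> n g f + (\<Sum>u\<in>new. c u * walsh_sum m (poly_lattice d (g(d := h)) f) u)" for h
    proof -
      have eq: "walsh_sum m (poly_lattice d (g(d := h)) f) u = walsh_sum m (poly_lattice n g f) u"
        if "u \<in> Pow {1..n} - {{}}" for u
        unfolding f(2)[symmetric]
        using that by (intro walsh_sum_poly_lattice_cong f0) (auto simp: d_def)
      show ?thesis
        unfolding merit_def sum_split c_def f(2)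
        by (intro arg_cong2[where f = "(+)"] sum.cong refl) (simp only: eq)
    qed
    have "merit a b \<gamma> d g f \<le> merit a b \<gamma> d (g(d := h)) f" if "h \<in> polys_below m" for h
      using cbc d f(2) that by (force simp: cbc_constructed_def is_arg_min_linorder)
    \<comment> \<open>The minimality inequalities are added over all \<open>2 ^ m\<close>
      candidates; the left side is \<open>2 ^ m\<close> times the minimum.\<close>
    then have "(\<Sum>h\<in>polys_below m. merit a b \<gamma> d g f) \<le> (\<Sum>h\<in>polys_below m. merit a b \<gamma> d (g(d := h)) f)"
      by (rule sum_mono)
    also have "\<dots> = 2 ^ m * merit a b \<gamma> n g f
        + (\<Sum>u\<in>new. c u * (\<Sum>h\<in>polys_below m. walsh_sum m (poly_lattice d (g(d := h)) f) u))"
      unfolding merit_eq sum.distrib sum_distrib_left by (subst sum.swap) (simp add: card_polys_below)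
    also have "\<dots> \<le> 2 ^ m * merit a b \<gamma> n g f + (\<Sum>u\<in>new. c u * (real m / 2) ^ card u)"
      using d by (intro add_left_mono sum_mono mult_left_mono sum_walsh_sum_le f c)
        (auto simp: new_def)
    finally have "merit a b \<gamma> d g f \<le> merit a b \<gamma> n g f + 1 / 2 ^ m * (\<Sum>u\<in>new. c u * (real m / 2) ^ card u)"
      by (simp add: card_polys_below field_simps)
    also have "\<dots> \<le> 1 / 2 ^ m * (\<Sum>u\<in>Pow {1..d} - {{}}. c u * (real m / 2) ^ card u)"
    proof -
      have "merit a b \<gamma> n g f \<le> 1 / 2 ^ m * (\<Sum>u\<in>Pow {1..n} - {{}}. c u * (real m / 2) ^ card u)"
        using step.IH step.prems by (simp add: c_def mult_ac)
      then show ?thesis unfolding sum_split distrib_left by (rule add_right_mono)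
    qed
    finally show ?case by (simp add: c_def d_def mult_ac)
  qed
qed


subsection \<open>Walsh functions on the dyadic grid\<close>

lemma sum_lessThan_double: "(\<Sum>k<2 * n. F k) = (\<Sum>k<n. F (2 * k) + F (2 * k + 1))"
  for F :: "nat \<Rightarrow> 'a :: comm_monoid_add"
  by (induction n) (simp_all add: add.assoc)

text \<open>The bits of \<open>k\<close> run through all 0-1 patterns, so this is the expansion of
  the product on the right. The induction splits off the lowest bit by parity.\<close>

lemma sum_bit_prod:
  fixes c :: "nat \<Rightarrow> real"
  shows "(\<Sum>k<(2::nat) ^ m. \<Prod>j<m. if bit k j then c j else 1) = (\<Prod>j<m. 1 + c j)"
proof (induction m arbitrary: c)
  case (Suc m)
  have "(\<Sum>k<(2::nat) ^ Suc m. \<Prod>j<Suc m. if bit k j then c j else 1)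
      = (\<Sum>k<(2::nat) ^ m. (1 + c 0) * (\<Prod>j<m. if bit k j then c (Suc j) else 1))"
    unfolding power_Suc sum_lessThan_double
    by (intro sum.cong refl) (simp add: prod.lessThan_Suc_shift bit_Suc bit_0 algebra_simps del: prod.lessThan_Suc)
  also have "\<dots> = (\<Prod>j<Suc m. 1 + c j)"
    by (simp add: Suc prod.lessThan_Suc_shift del: prod.lessThan_Suc flip: sum_distrib_left)
  finally show ?case .
qed simp

text \<open>Orthogonality in its dual form, summed over the index with the points fixed, as needed
  for inverting the transform. A bit in which \<open>i\<close> and \<open>j\<close> differ yields a
  factor 1 - 1.\<close>

lemma sum_walsh_mult_walsh:
  assumes "i < 2 ^ m" "j < 2 ^ m"
  shows "(\<Sum>k<(2::nat) ^ m. walsh k (real i / 2 ^ m) * walsh k (real j / 2 ^ m)) = 2 ^ m * of_bool (i = j)"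
proof -
  define sgn where "sgn n t = (if bit n (m - Suc t) then -1 else 1 :: real)" for n t :: nat
  have "(\<Sum>k<(2::nat) ^ m. walsh k (real i / 2 ^ m) * walsh k (real j / 2 ^ m))
      = (\<Sum>k<(2::nat) ^ m. \<Prod>t<m. if bit k t then sgn i t * sgn j t else 1)"
    by (intro sum.cong refl)
       (auto simp: walsh_grid_eq_prod sgn_def simp flip: prod.distrib intro!: prod.cong)
  also have "\<dots> = (\<Prod>t<m. 1 + sgn i t * sgn j t)"
    by (rule sum_bit_prod)
  also have "\<dots> = 2 ^ m * of_bool (i = j)"
  proof (cases "i = j")
    case True
    moreover have "1 + sgn j t * sgn j t = 2" for t by (simp add: sgn_def)
    ultimately show ?thesis by simp
  next
    case False
    then obtain t where t: "bit i t \<noteq> bit j t" by (auto simp: bit_eq_iff)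
    then have "t < m" using assms not_bit_if_less[of _ m t] by (meson not_le)
    \<comment> \<open>\<open>sgn\<close> reads the bits in reversed order, so bit \<open>t\<close>
      belongs to the factor \<open>m - Suc t\<close>.\<close>
    then have "1 + sgn i (m - Suc t) * sgn j (m - Suc t) = 0" "m - Suc t < m"
      using t by (auto simp: sgn_def)
    then have "(\<Prod>t<m. 1 + sgn i t * sgn j t) = 0" by (intro prod_zero) auto
    then show ?thesis using False by simp
  qed
  finally show ?thesis .
qed

lemma walsh_0 [simp]: "walsh 0 x = 1"
  by (simp add: walsh_def dyadic_mu_def floorlog_def)

lemma abs_walsh [simp]: "\<bar>walsh k x\<bar> = 1"
  by (simp add: walsh_def)

section \<open>Cancellation in one-dimensional Walsh transforms\<close>

lemma bit_dyadic_mu: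
  assumes "dyadic_mu k = Suc l" shows "bit k l"
proof -
  have "0 < k" using assms by (cases "k = 0") (auto simp: dyadic_mu_def floorlog_def)
  then have "2 ^ l \<le> k"
    using floorlog_bounds[of k 2] assms by (simp add: dyadic_mu_def)
  moreover have "k < 2 ^ Suc l" using less_power_dyadic_mu[of k] assms by simp
  ultimately have "k div 2 ^ l = 1"
    by (intro div_nat_eqI) simp_all
  then show ?thesis by (simp add: bit_iff_odd)
qed

text \<open>\<open>walsh k\<close> depends only on the first \<open>l\<close> digits, and
  \<open>t\<close> affects only the later ones.\<close>

lemma walsh_refined_grid:
  assumes "dyadic_mu k = l" "l \<le> m" "t < 2 ^ (m - l)"
  shows "walsh k (real (q * 2 ^ (m - l) + t) / 2 ^ m) = walsh k (real q / 2 ^ l)"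
proof -
  define n where "n = q * 2 ^ (m - l) + t"
  have "n div 2 ^ (m - l) = q"
    using assms(3) by (simp add: n_def div_add1_eq)
  then have shift: "bit n (m - l + i) = bit q i" for i
    by (simp add: bit_iff_odd power_add div_mult2_eq)
  have k: "k < 2 ^ l" using less_power_dyadic_mu[of k] assms(1) by simp
  have "walsh k (real n / 2 ^ m) = (\<Prod>j<l. if bit k j \<and> odd (dyadic_digit (real n / 2 ^ m) (Suc j)) then -1 else 1)"
    by (rule walsh_eq_prod[OF k])
  also have "\<dots> = (\<Prod>j<l. if bit k j \<and> bit q (l - Suc j) then -1 else 1)"
  proof (intro prod.cong refl)
    fix j assume "j \<in> {..<l}"
    then have "m - Suc j = m - l + (l - Suc j)" "Suc j \<le> m" using assms(2) by auto
    then show "(if bit k j \<and> odd (dyadic_digit (real n / 2 ^ m) (Suc j)) then -1 else 1 :: real)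
        = (if bit k j \<and> bit q (l - Suc j) then -1 else 1)"
      by (simp only: dyadic_digit_grid shift) simp
  qed
  also have "\<dots> = walsh k (real q / 2 ^ l)"
    by (rule walsh_grid_eq_prod[OF k, symmetric])
  finally show ?thesis by (simp only: n_def)
qed

text \<open>The two numerators differ only in the last bit, which meets the leading bit of
  \<open>k\<close>, and that bit is 1.\<close>

lemma walsh_odd_grid:
  assumes "dyadic_mu k = Suc l"
  shows "walsh k (real (2 * p + 1) / 2 ^ Suc l) = - walsh k (real (2 * p) / 2 ^ Suc l)"
proof -
  have k: "k < 2 ^ Suc l" using less_power_dyadic_mu[of k] assms by simp
  have "bit (2 * p + 1) (Suc l - Suc j) = bit (2 * p) (Suc l - Suc j)" if "j < l" for j
  proof -
    have "Suc l - Suc j = Suc (l - Suc j)" using that by simp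
    then show ?thesis by (simp only: bit_Suc) simp
  qed
  then have "(\<Prod>j<l. if bit k j \<and> bit (2 * p + 1) (Suc l - Suc j) then -1 else 1 :: real)
      = (\<Prod>j<l. if bit k j \<and> bit (2 * p) (Suc l - Suc j) then -1 else 1)"
    by (intro prod.cong refl) simp
  then show ?thesis
    unfolding walsh_grid_eq_prod[OF k] prod.lessThan_Suc
    using bit_dyadic_mu[OF assms] by (simp add: bit_0)
qed

text \<open>The increments left out are nonnegative, so inserting them gives a larger, telescoping
  sum.\<close>

lemma sum_odd_increments_le:
  fixes D :: "nat \<Rightarrow> real"
  assumes "\<And>q. Suc q < 2 * n \<Longrightarrow> D q \<le> D (Suc q)" "n > 0"
  shows "(\<Sum>p<n. D (2 * p + 1) - D (2 * p)) \<le> D (2 * n - 1) - D 0"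
  using assms(2,1)
proof (induction n rule: nat_induct_non_zero)
  case (Suc n)
  have "D (2 * n - 1) \<le> D (2 * n)" using Suc.prems[of "2 * n - 1"] Suc.hyps by simp
  moreover have "(\<Sum>p<n. D (2 * p + 1) - D (2 * p)) \<le> D (2 * n - 1) - D 0"
    using Suc.prems by (intro Suc.IH) simp
  ultimately show ?case by simp
qed simp

text \<open>With \<open>l = dyadic_mu k\<close>, the function \<open>walsh k\<close> takes opposite values at grid points whose
  numerators differ by \<open>2 ^ (m - l)\<close> within a dyadic interval of length \<open>2 / 2 ^ l\<close>. Pairing these
  points leaves, for each of the \<open>2 ^ (m - l)\<close> residues, a sum of increments of \<open>\<Phi>\<close> over disjoint
  intervals.\<close>

lemma walsh_transform_bound:
  fixes \<Phi> C :: "nat \<Rightarrow> real"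
  assumes k: "0 < k" "k < 2 ^ m" and L: "0 \<le> L"
    and mono: "\<And>i j. i \<le> j \<Longrightarrow> j < 2 ^ m \<Longrightarrow> C i \<le> C j"
    and bounds: "\<And>j. j < 2 ^ m \<Longrightarrow> A \<le> C j \<and> C j \<le> B"
    and lip: "\<And>i j. i \<le> j \<Longrightarrow> j < 2 ^ m \<Longrightarrow> \<bar>\<Phi> i - \<Phi> j\<bar> \<le> L * (C j - C i)"
  shows "\<bar>\<Sum>j<2 ^ m. walsh k (real j / 2 ^ m) * \<Phi> j\<bar> \<le> L * (2 ^ (m - dyadic_mu k) * (B - A))"
proof -
  have "dyadic_mu k \<noteq> 0" using k(1) less_power_dyadic_mu[of k] by (intro notI) simp
  then obtain l where l: "dyadic_mu k = Suc l" by (cases "dyadic_mu k") auto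
  have lm: "Suc l \<le> m" using dyadic_mu_le[OF k(2)] l by simp
  \<comment> \<open>The number of grid points in a dyadic interval of length
    \<open>1 / 2 ^ Suc l\<close>, on which \<open>walsh k\<close> is constant. Numerators are
    written as \<open>q * r + t\<close> with \<open>t < r\<close>.\<close>
  define r :: nat where "r = 2 ^ (m - Suc l)"
  have m: "2 ^ m = 2 * 2 ^ l * r"
    using lm by (simp add: r_def flip: power_Suc power_add)
  have less: "q * r + t < 2 ^ m" if "q < 2 * 2 ^ l" "t < r" for q t
  proof -
    have "q * r + t < Suc q * r" using that by simp
    also have "\<dots> \<le> 2 * 2 ^ l * r" using that by (intro mult_right_mono) simp_all
    finally show ?thesis by (simp only: m)
  qed
  define w where "w q = walsh k (real q / 2 ^ Suc l)" for q
  have "(\<Sum>j<2 ^ m. walsh k (real j / 2 ^ m) * \<Phi> j)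
      = (\<Sum>q<(2::nat) * 2 ^ l. \<Sum>j=q * r..<q * r + r. walsh k (real j / 2 ^ m) * \<Phi> j)"
    unfolding m by (rule sum.nat_group[symmetric])
  also have "\<dots> = (\<Sum>q<(2::nat) * 2 ^ l. \<Sum>t<r. w q * \<Phi> (q * r + t))"
  proof (rule sum.cong[OF refl])
    fix q
    have "(\<Sum>j=q * r..<q * r + r. walsh k (real j / 2 ^ m) * \<Phi> j)
        = (\<Sum>t<r. walsh k (real (q * r + t) / 2 ^ m) * \<Phi> (q * r + t))"
      by (rule sum.reindex_bij_witness[where i = "\<lambda>t. q * r + t" and j = "\<lambda>j. j - q * r"]) auto
    also have "\<dots> = (\<Sum>t<r. w q * \<Phi> (q * r + t))"
      unfolding w_def r_def by (intro sum.cong refl) (simp only: walsh_refined_grid[OF l lm] lessThan_iff)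
    finally show "(\<Sum>j=q * r..<q * r + r. walsh k (real j / 2 ^ m) * \<Phi> j)
        = (\<Sum>t<r. w q * \<Phi> (q * r + t))" .
  qed
  also have "\<dots> = (\<Sum>p<(2::nat) ^ l. \<Sum>t<r. w (2 * p) * (\<Phi> (2 * p * r + t) - \<Phi> ((2 * p + 1) * r + t)))"
    unfolding sum_lessThan_double
    by (simp only: w_def walsh_odd_grid[OF l] right_diff_distrib sum_subtractf
        mult_minus_left sum_negf add_uminus_conv_diff)
  finally have sum_eq: "(\<Sum>j<2 ^ m. walsh k (real j / 2 ^ m) * \<Phi> j)
      = (\<Sum>p<(2::nat) ^ l. \<Sum>t<r. w (2 * p) * (\<Phi> (2 * p * r + t) - \<Phi> ((2 * p + 1) * r + t)))" .
  have "\<bar>\<Sum>j<2 ^ m. walsh k (real j / 2 ^ m) * \<Phi> j\<bar>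
      \<le> (\<Sum>p<(2::nat) ^ l. \<Sum>t<r. \<bar>w (2 * p) * (\<Phi> (2 * p * r + t) - \<Phi> ((2 * p + 1) * r + t))\<bar>)"
    unfolding sum_eq by (intro order.trans[OF sum_abs] sum_mono sum_abs)
  also have "\<dots> \<le> (\<Sum>p<(2::nat) ^ l. \<Sum>t<r. L * (C ((2 * p + 1) * r + t) - C (2 * p * r + t)))"
    by (intro sum_mono) (simp only: abs_mult w_def abs_walsh mult_1_left, intro lip less, simp_all)
  also have "\<dots> = (\<Sum>t<r. L * (\<Sum>p<(2::nat) ^ l. C ((2 * p + 1) * r + t) - C (2 * p * r + t)))"
    by (subst sum.swap) (simp add: sum_distrib_left)
  also have "\<dots> \<le> (\<Sum>t<r. L * (B - A))"
  proof (intro sum_mono mult_left_mono L)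
    fix t assume "t \<in> {..<r}"
    then have t: "t < r" by simp
    have "(\<Sum>p<(2::nat) ^ l. C ((2 * p + 1) * r + t) - C (2 * p * r + t))
        \<le> C ((2 * 2 ^ l - 1) * r + t) - C (0 * r + t)"
    proof (rule sum_odd_increments_le[where D = "\<lambda>q. C (q * r + t)"])
      fix q assume "Suc q < 2 * 2 ^ l"
      then show "C (q * r + t) \<le> C (Suc q * r + t)" by (intro mono less t) simp_all
    qed simp
    also have "\<dots> \<le> B - A"
    proof -
      have "(2 * 2 ^ l - 1) * r + t < 2 ^ m" "0 * r + t < 2 ^ m"
        using t by (intro less; simp)+
      then show ?thesis using bounds by (meson diff_mono)
    qed
    finally show "(\<Sum>p<(2::nat) ^ l. C ((2 * p + 1) * r + t) - C (2 * p * r + t)) \<le> B - A" .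
  qed
  also have "\<dots> = L * (2 ^ (m - dyadic_mu k) * (B - A))" by (simp add: r_def l)
  finally show ?thesis .
qed


subsection \<open>Grids and Walsh coefficients\<close>

text \<open>The unnormalized transform in the listed coordinates only, the others staying free. This
  form allows estimates one coordinate at a time.\<close>

primrec walsh_op ::
  "nat \<Rightarrow> (nat \<Rightarrow> nat) \<Rightarrow> (nat \<Rightarrow> nat \<Rightarrow> real) \<Rightarrow> nat list \<Rightarrow> ((nat \<Rightarrow> real) \<Rightarrow> real)
     \<Rightarrow> (nat \<Rightarrow> real) \<Rightarrow> real" where
  "walsh_op m k C [] H x = H x"
| "walsh_op m k C (i # is) H x =
     (\<Sum>j<2 ^ m. walsh (k i) (real j / 2 ^ m) * walsh_op m k C is H (x(i := C i j)))"

lemma walsh_op_append: "walsh_op m k C (is @ js) H x = walsh_op m k C is (walsh_op m k C js H) x"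
  by (induction "is" arbitrary: x) simp_all

text \<open>Transforms in different coordinates commute, so the last one can be moved outside. It is
  needed there because the last variable of the list is the first to be differentiated.\<close>

lemma walsh_op_snoc:
  assumes "i \<notin> set is"
  shows "walsh_op m k C (is @ [i]) H x =
    (\<Sum>j<2 ^ m. walsh (k i) (real j / 2 ^ m) * walsh_op m k C is H (x(i := C i j)))"
  using assms
proof (induction "is" arbitrary: x)
  case (Cons i' "is")
  then have "i' \<noteq> i" by auto
  then have twist: "x(i' := s, i := t) = x(i := t, i' := s)" for s t by (rule fun_upd_twist)
  have "walsh_op m k C ((i' # is) @ [i]) H x =
    (\<Sum>j'<2 ^ m. \<Sum>j<2 ^ m. walsh (k i') (real j' / 2 ^ m) * (walsh (k i) (real j / 2 ^ m) *
       walsh_op m k C is H (x(i' := C i' j', i := C i j))))"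
    using Cons by (simp add: sum_distrib_left del: fun_upd_apply)
  also have "\<dots> = (\<Sum>j<2 ^ m. \<Sum>j'<2 ^ m. walsh (k i) (real j / 2 ^ m) * (walsh (k i') (real j' / 2 ^ m) *
       walsh_op m k C is H (x(i := C i j, i' := C i' j'))))"
    by (subst sum.swap) (simp add: twist mult.left_commute del: fun_upd_apply)
  also have "\<dots> = (\<Sum>j<2 ^ m. walsh (k i) (real j / 2 ^ m) * walsh_op m k C (i' # is) H (x(i := C i j)))"
    by (simp add: sum_distrib_left)
  finally show ?case .
qed simp

lemma sum_PiE_insert:
  assumes "i \<notin> S"
  shows "(\<Sum>j\<in>Pi\<^sub>E (insert i S) T. F j) = (\<Sum>v\<in>T i. \<Sum>j\<in>Pi\<^sub>E S T. F (j(i := v)))"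
  unfolding PiE_insert_eq
  by (subst sum.reindex[OF inj_combinator[OF assms]]) (simp add: sum.cartesian_product case_prod_unfold)

text \<open>Links the iterated form, suited to induction, with the multivariate sum in
  \<open>walsh_coeff\<close>.\<close>

lemma walsh_op_eq_sum:
  assumes "distinct is"
  shows "walsh_op m k C is H x =
    (\<Sum>j\<in>Pi\<^sub>E (set is) (\<lambda>_. {..<2 ^ m}). (\<Prod>i\<in>set is. walsh (k i) (real (j i) / 2 ^ m)) *
       H (\<lambda>i. if i \<in> set is then C i (j i) else x i))"
  using assms
proof (induction "is" arbitrary: x)
  case (Cons i "is")
  have [simp]: "i \<notin> set is" using Cons.prems by simp
  have "(\<Sum>j\<in>Pi\<^sub>E (set is) (\<lambda>_. {..<2 ^ m}). (\<Prod>l\<in>set is. walsh (k l) (real (j l) / 2 ^ m)) *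
       H (\<lambda>l. if l \<in> set is then C l (j l) else (x(i := C i v)) l)) * walsh (k i) (real v / 2 ^ m)
     = (\<Sum>j\<in>Pi\<^sub>E (set is) (\<lambda>_. {..<2 ^ m}).
          (\<Prod>l\<in>set (i # is). walsh (k l) (real ((j(i := v)) l) / 2 ^ m)) *
          H (\<lambda>l. if l \<in> set (i # is) then C l ((j(i := v)) l) else x l))" for v
    unfolding sum_distrib_right
  proof (rule sum.cong[OF refl])
    fix j :: "nat \<Rightarrow> nat"
    have "(\<Prod>l\<in>set is. walsh (k l) (real ((j(i := v)) l) / 2 ^ m)) = (\<Prod>l\<in>set is. walsh (k l) (real (j l) / 2 ^ m))"
      by (intro prod.cong refl) auto
    moreover have "(\<lambda>l. if l \<in> set is then C l (j l) else (x(i := C i v)) l)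
        = (\<lambda>l. if l \<in> set (i # is) then C l ((j(i := v)) l) else x l)"
      by auto
    ultimately show "(\<Prod>l\<in>set is. walsh (k l) (real (j l) / 2 ^ m)) *
       H (\<lambda>l. if l \<in> set is then C l (j l) else (x(i := C i v)) l) * walsh (k i) (real v / 2 ^ m)
      = (\<Prod>l\<in>set (i # is). walsh (k l) (real ((j(i := v)) l) / 2 ^ m)) *
          H (\<lambda>l. if l \<in> set (i # is) then C l ((j(i := v)) l) else x l)"
      by simp
  qed
  then show ?case
    using Cons by (simp add: sum_PiE_insert mult.commute)
qed simp

section \<open>Walsh transforms and partial derivatives\<close>

lemma iter_partial_append: "iter_partial a b (is @ js) F = iter_partial a b is (iter_partial a b js F)"
  by (induction "is") simp_all

lemma iter_partial_exists_append:
  "iter_partial_exists d a b (is @ js) F \<longleftrightarrow>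
     iter_partial_exists d a b js F \<and> iter_partial_exists d a b is (iter_partial a b js F)"
  by (induction "is") (auto simp: iter_partial_append)

lemma cuboid_fun_upd: "x \<in> cuboid d a b \<Longrightarrow> i \<in> {1..d} \<Longrightarrow> t \<in> {a i..b i} \<Longrightarrow> x(i := t) \<in> cuboid d a b"
  unfolding cuboid_def by (auto simp: PiE_iff extensional_def)

lemma cuboidD: "x \<in> cuboid d a b \<Longrightarrow> i \<in> {1..d} \<Longrightarrow> x i \<in> {a i..b i}"
  unfolding cuboid_def by (auto dest: PiE_mem)

text \<open>The abstract grid function \<open>C i j\<close> is used with the quantile \<open>\<Phi>\<^sub>i\<^sup>-\<^sup>1(j / 2\<^sup>m)\<close> and, to prove that the
  integrand is measurable, with equidistant points.\<close>

locale mapped_grid =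
  fixes d m :: nat and a b :: "nat \<Rightarrow> real" and C :: "nat \<Rightarrow> nat \<Rightarrow> real"
  assumes less: "\<And>i. i \<in> {1..d} \<Longrightarrow> a i < b i"
    and C_0: "\<And>i. i \<in> {1..d} \<Longrightarrow> C i 0 = a i"
    and C_power: "\<And>i. i \<in> {1..d} \<Longrightarrow> C i (2 ^ m) = b i"
    and C_mono: "\<And>i j j'. i \<in> {1..d} \<Longrightarrow> j \<le> j' \<Longrightarrow> j' \<le> 2 ^ m \<Longrightarrow> C i j \<le> C i j'"
begin

lemma C_bounds: "i \<in> {1..d} \<Longrightarrow> j \<le> 2 ^ m \<Longrightarrow> C i j \<in> {a i..b i}"
  using C_mono[of i 0 j] C_mono[of i j "2 ^ m"] by (simp add: C_0 C_power)

lemma upd_C: "x \<in> cuboid d a b \<Longrightarrow> i \<in> {1..d} \<Longrightarrow> j < 2 ^ m \<Longrightarrow> x(i := C i j) \<in> cuboid d a b"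
  by (intro cuboid_fun_upd C_bounds) simp_all

text \<open>The transform is a finite linear combination of values with other coordinates replaced,
  so it commutes with differentiation in \<open>i\<close>.\<close>

lemma has_derivative_walsh_op:
  assumes i: "i \<in> {1..d}" "i \<notin> set is" "set is \<subseteq> {1..d}"
    and H: "\<And>x. x \<in> cuboid d a b \<Longrightarrow>
      ((\<lambda>t. H (x(i := t))) has_real_derivative H' x) (at (x i) within {a i..b i})"
    and x: "x \<in> cuboid d a b"
  shows "((\<lambda>t. walsh_op m k C is H (x(i := t))) has_real_derivative walsh_op m k C is H' x)
    (at (x i) within {a i..b i})"
  using i(2,3) x
proof (induction "is" arbitrary: x)
  case (Cons i' "is")
  have "((\<lambda>t. walsh_op m k C is H (x(i' := C i' j, i := t))) has_real_derivative
      walsh_op m k C is H' (x(i' := C i' j))) (at (x i) within {a i..b i})" if "j < 2 ^ m" for j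
  proof -
    have "(x(i' := C i' j)) i = x i" using Cons.prems by simp
    then show ?thesis
      using Cons.IH[of "x(i' := C i' j)"] Cons.prems upd_C[of x i' j] that
      by (simp del: fun_upd_apply)
  qed
  moreover have "i \<noteq> i'" using Cons.prems by auto
  ultimately show ?case
    by (auto simp: fun_upd_twist[of i i'] simp del: fun_upd_apply intro!: DERIV_sum DERIV_cmult)
qed (simp add: H)

text \<open>The induction hypothesis for the derivative \<open>F'\<close> in the last listed
  variable gives a Lipschitz constant in that variable for the transform over the remaining ones.
  Then \<open>walsh_transform_bound\<close> supplies the next factor.\<close>

lemma walsh_op_bound:
  assumes "distinct is" "set is \<subseteq> {1..d}" "\<And>i. i \<in> set is \<Longrightarrow> 0 < k i \<and> k i < 2 ^ m"
    and "iter_partial_exists d a b is F"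
    and "\<And>x. x \<in> cuboid d a b \<Longrightarrow> \<bar>iter_partial a b is F x\<bar> \<le> M"
    and "x \<in> cuboid d a b"
  shows "\<bar>walsh_op m k C is F x\<bar> \<le> M * (\<Prod>i\<in>set is. 2 ^ (m - dyadic_mu (k i)) * (b i - a i))"
  using assms
proof (induction "is" arbitrary: F x rule: rev_induct)
  case (snoc i "is")
  define F' where "F' = iter_partial a b [i] F"
  define L where "L = M * (\<Prod>i\<in>set is. 2 ^ (m - dyadic_mu (k i)) * (b i - a i))"
  have i: "i \<in> {1..d}" "i \<notin> set is" using snoc.prems by auto
  have exists: "iter_partial_exists d a b [i] F" "iter_partial_exists d a b is F'"
    using snoc.prems(4) by (simp_all add: iter_partial_exists_append F'_def)
  have L: "\<bar>walsh_op m k C is F' y\<bar> \<le> L" if "y \<in> cuboid d a b" for y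
    unfolding L_def using snoc.prems exists that
    by (intro snoc.IH) (simp_all add: iter_partial_append F'_def)
  have F': "((\<lambda>t. F (y(i := t))) has_real_derivative F' y) (at (y i) within {a i..b i})"
    if "y \<in> cuboid d a b" for y
    using exists(1) that
    by (simp add: F'_def has_real_derivative_iff_has_vector_derivative vector_derivative_works)
  define \<Phi> where "\<Phi> = (\<lambda>t. walsh_op m k C is F (x(i := t)))"
  have \<Phi>': "(\<Phi> has_real_derivative walsh_op m k C is F' (x(i := t))) (at t within {a i..b i})"
    if "t \<in> {a i..b i}" for t
    using has_derivative_walsh_op[OF i _ F' cuboid_fun_upd[OF snoc.prems(6) i(1) that]] snoc.prems(2)
    by (simp add: \<Phi>_def)
  have "\<bar>walsh_op m k C (is @ [i]) F x\<bar> = \<bar>\<Sum>j<2 ^ m. walsh (k i) (real j / 2 ^ m) * \<Phi> (C i j)\<bar>"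
    by (simp only: walsh_op_snoc[OF i(2)] \<Phi>_def)
  also have "\<dots> \<le> L * (2 ^ (m - dyadic_mu (k i)) * (b i - a i))"
  proof (rule walsh_transform_bound)
    show "0 < k i" "k i < 2 ^ m" using snoc.prems(3)[of i] by simp_all
    show "0 \<le> L" using L[OF snoc.prems(6)] by linarith
    fix j' assume j': "j' < (2::nat) ^ m"
    show "a i \<le> C i j' \<and> C i j' \<le> b i" using C_bounds[OF i(1), of j'] j' by simp
    fix j assume j: "j \<le> j'"
    show le: "C i j \<le> C i j'" using C_mono[OF i(1) j] j' by simp
    have "norm (\<Phi> (C i j) - \<Phi> (C i j')) \<le> L * norm (C i j - C i j')"
    proof (rule field_differentiable_bound[OF convex_real_interval(5) \<Phi>'])
      show "C i j \<in> {a i..b i}" "C i j' \<in> {a i..b i}" using j j' i(1) by (intro C_bounds; simp)+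
      fix t assume "t \<in> {a i..b i}"
      then show "norm (walsh_op m k C is F' (x(i := t))) \<le> L"
        using L[OF cuboid_fun_upd[OF snoc.prems(6) i(1)]] by simp
    qed
    then show "\<bar>\<Phi> (C i j) - \<Phi> (C i j')\<bar> \<le> L * (C i j' - C i j)"
      using le by simp
  qed
  also have "\<dots> = M * (\<Prod>i\<in>set (is @ [i]). 2 ^ (m - dyadic_mu (k i)) * (b i - a i))"
    using i(2) by (simp add: L_def mult_ac)
  finally show ?case .
qed simp

text \<open>Meant for coordinates with index 0, where there is no cancellation; the factor
  \<open>2 ^ m\<close> for each of them is absorbed by the normalization of
  \<open>walsh_coeff\<close>.\<close>

lemma walsh_op_trivial_bound:
  assumes "\<And>x. x \<in> cuboid d a b \<Longrightarrow> \<bar>H x\<bar> \<le> M" "set is \<subseteq> {1..d}" "x \<in> cuboid d a b"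
  shows "\<bar>walsh_op m k C is H x\<bar> \<le> (2 ^ m) ^ length is * M"
  using assms(2,3)
proof (induction "is" arbitrary: x)
  case (Cons i "is")
  have "\<bar>walsh_op m k C (i # is) H x\<bar> \<le> (\<Sum>j<2 ^ m. \<bar>walsh_op m k C is H (x(i := C i j))\<bar>)"
    by (simp, intro order.trans[OF sum_abs]) (simp add: abs_mult)
  also have "\<dots> \<le> (\<Sum>j<(2::nat) ^ m. (2 ^ m) ^ length is * M)"
    using Cons by (intro sum_mono Cons.IH upd_C) auto
  finally show ?case by (simp add: mult_ac)
qed (use assms(1) in simp)

section \<open>Walsh expansion on the grid\<close>

definition grid_point :: "(nat \<Rightarrow> nat) \<Rightarrow> nat \<Rightarrow> real" where
  "grid_point j = (\<lambda>i\<in>{1..d}. C i (j i))"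

abbreviation grid :: "(nat \<Rightarrow> nat) set" where
  "grid \<equiv> Pi\<^sub>E {1..d} (\<lambda>_. {..<2 ^ m})"

lemma grid_point_in_cuboid: "(\<And>i. i \<in> {1..d} \<Longrightarrow> j i \<le> 2 ^ m) \<Longrightarrow> grid_point j \<in> cuboid d a b"
  using C_bounds by (auto simp: grid_point_def cuboid_def)

lemma finite_grid: "finite grid" by (intro finite_PiE) auto

text \<open>The Walsh functions see the equidistant points \<open>j / 2 ^ m\<close>, while
  \<open>F\<close> sees their images under the grid map.\<close>

definition walsh_coeff :: "((nat \<Rightarrow> real) \<Rightarrow> real) \<Rightarrow> (nat \<Rightarrow> nat) \<Rightarrow> real" where
  "walsh_coeff F k = 1 / (2 ^ m) ^ d *
     (\<Sum>j\<in>grid. (\<Prod>i=1..d. walsh (k i) (real (j i) / 2 ^ m)) * F (grid_point j))"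

text \<open>An exact identity without truncation error: inserting the coefficients and summing over
  \<open>k\<close> first leaves, by \<open>sum_walsh_mult_walsh\<close> in each coordinate, only the
  term of \<open>J\<close>.\<close>

lemma walsh_expansion:
  assumes J: "\<And>i. i \<in> {1..d} \<Longrightarrow> J i < 2 ^ m"
  shows "F (grid_point J) = (\<Sum>k\<in>grid. walsh_coeff F k * (\<Prod>i=1..d. walsh (k i) (real (J i) / 2 ^ m)))"
proof -
  define J' where "J' = restrict J {1..d}"
  have J': "J' \<in> grid" using J by (auto simp: J'_def)
  have "(\<Sum>k\<in>grid. walsh_coeff F k * (\<Prod>i=1..d. walsh (k i) (real (J i) / 2 ^ m)))
     = (\<Sum>k\<in>grid. \<Sum>j\<in>grid. 1 / (2 ^ m) ^ d * F (grid_point j) *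
          (\<Prod>i=1..d. walsh (k i) (real (j i) / 2 ^ m) * walsh (k i) (real (J i) / 2 ^ m)))"
    by (simp only: walsh_coeff_def sum_distrib_left sum_distrib_right prod.distrib mult_ac)
  also have "\<dots> = (\<Sum>j\<in>grid. 1 / (2 ^ m) ^ d * F (grid_point j) *
      (\<Sum>k\<in>grid. \<Prod>i=1..d. walsh (k i) (real (j i) / 2 ^ m) * walsh (k i) (real (J i) / 2 ^ m)))"
    by (subst sum.swap) (simp only: sum_distrib_left)
  also have "\<dots> = (\<Sum>j\<in>grid. if j = J' then F (grid_point j) else 0)"
  proof (rule sum.cong[OF refl])
    fix j assume j: "j \<in> grid"
    have "(\<Sum>k\<in>grid. \<Prod>i=1..d. walsh (k i) (real (j i) / 2 ^ m) * walsh (k i) (real (J i) / 2 ^ m))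
        = (\<Prod>i=1..d. \<Sum>k<2 ^ m. walsh k (real (j i) / 2 ^ m) * walsh k (real (J i) / 2 ^ m))"
      by (rule prod_sum_PiE[symmetric]) simp_all
    also have "\<dots> = (\<Prod>i=1..d. 2 ^ m * of_bool (j i = J i))"
      using j J by (intro prod.cong refl sum_walsh_mult_walsh) auto
    also have "\<dots> = (2 ^ m) ^ d * of_bool (j = J')"
    proof (cases "j = J'")
      case False
      then obtain i where "i \<in> {1..d}" "j i \<noteq> J i"
        using PiE_ext[OF j J'] by (auto simp: J'_def)
      then have "(\<Prod>i=1..d. 2 ^ m * of_bool (j i = J i)) = (0::real)"
        by (intro prod_zero) auto
      then show ?thesis using False by simp
    qed (simp add: J'_def)
    finally show "1 / (2 ^ m) ^ d * F (grid_point j) *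
        (\<Sum>k\<in>grid. \<Prod>i=1..d. walsh (k i) (real (j i) / 2 ^ m) * walsh (k i) (real (J i) / 2 ^ m))
      = (if j = J' then F (grid_point j) else 0)" by simp
  qed
  also have "\<dots> = F (grid_point J')"
    using J' finite_grid by simp
  also have "grid_point J' = grid_point J"
    by (auto simp: grid_point_def J'_def)
  finally show ?thesis by simp
qed

text \<open>A multi-index corresponds to its support together with its nonzero entries, which is how
  the figure of merit is indexed.\<close>

lemma sum_grid_by_support:
  fixes T :: "(nat \<Rightarrow> nat) \<Rightarrow> real"
  shows "(\<Sum>k\<in>grid. T k) = (\<Sum>u\<in>Pow {1..d}. \<Sum>k\<in>Pi\<^sub>E u (\<lambda>_. {1..2 ^ m - 1}).
     T (\<lambda>i\<in>{1..d}. if i \<in> u then k i else 0))"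
proof -
  have "(\<Sum>(u, k)\<in>Sigma (Pow {1..d}) (\<lambda>u. Pi\<^sub>E u (\<lambda>_. {1..2 ^ m - 1})). T (\<lambda>i\<in>{1..d}. if i \<in> u then k i else 0))
      = (\<Sum>k\<in>grid. T k)"
  proof (rule sum.reindex_bij_witness[where
        i = "\<lambda>k. ({i\<in>{1..d}. k i \<noteq> 0}, restrict k {i\<in>{1..d}. k i \<noteq> 0})" and
        j = "\<lambda>(u, k). \<lambda>i\<in>{1..d}. if i \<in> u then k i else 0"])
    fix p :: "nat set \<times> (nat \<Rightarrow> nat)"
    assume "p \<in> Sigma (Pow {1..d}) (\<lambda>u. Pi\<^sub>E u (\<lambda>_. {1..2 ^ m - 1}))"
    then obtain u k where p: "p = (u, k)" "u \<subseteq> {1..d}" and k: "k \<in> Pi\<^sub>E u (\<lambda>_. {1..2 ^ m - 1})" by auto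
    have k': "1 \<le> k i" "k i < 2 ^ m" if "i \<in> u" for i
      using PiE_mem[OF k that] by (simp_all only: atLeastAtMost_iff le_power_minus_1_iff)
    have k0: "k i \<noteq> 0" if "i \<in> u" for i using k'(1)[OF that] by simp
    have u: "{i \<in> {1..d}. (\<lambda>i\<in>{1..d}. if i \<in> u then k i else 0) i \<noteq> 0} = u"
      using p(2) k0 by auto
    have "restrict (\<lambda>i\<in>{1..d}. if i \<in> u then k i else 0) u = k"
      using p(2) PiE_arb[OF k] by (auto simp: restrict_def fun_eq_iff)
    then show "(case case p of (u, k) \<Rightarrow> \<lambda>i\<in>{1..d}. if i \<in> u then k i else 0 of
         k \<Rightarrow> ({i\<in>{1..d}. k i \<noteq> 0}, restrict k {i\<in>{1..d}. k i \<noteq> 0})) = p"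
      by (simp only: p(1) prod.case u)
    show "(case p of (u, k) \<Rightarrow> \<lambda>i\<in>{1..d}. if i \<in> u then k i else 0) \<in> grid"
      using k' by (auto simp: p(1))
    show "T (case p of (u, k) \<Rightarrow> \<lambda>i\<in>{1..d}. if i \<in> u then k i else 0) =
       (case p of (u, k) \<Rightarrow> T (\<lambda>i\<in>{1..d}. if i \<in> u then k i else 0))"
      by (simp add: p(1))
  next
    fix k assume k: "k \<in> grid"
    have "k i \<in> {1..2 ^ m - 1}" if "i \<in> {1..d}" "k i \<noteq> 0" for i
      using PiE_mem[OF k that(1)] that(2) unfolding atLeastAtMost_iff le_power_minus_1_iff by simp
    then show "({i\<in>{1..d}. k i \<noteq> 0}, restrict k {i\<in>{1..d}. k i \<noteq> 0})
        \<in> Sigma (Pow {1..d}) (\<lambda>u. Pi\<^sub>E u (\<lambda>_. {1..2 ^ m - 1}))"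
      by (auto simp del: One_nat_def)
    show "(case ({i\<in>{1..d}. k i \<noteq> 0}, restrict k {i\<in>{1..d}. k i \<noteq> 0}) of
        (u, k) \<Rightarrow> \<lambda>i\<in>{1..d}. if i \<in> u then k i else 0) = k"
      using PiE_arb[OF k] by (auto simp: fun_eq_iff restrict_def)
  qed
  then show ?thesis by (subst sum.Sigma) (auto intro!: finite_PiE intro: finite_subset)
qed

end

text \<open>The bounds express that \<open>F\<close> lies in the unit ball of the norm, with real
  instead of extended real numbers; see \<open>abs_mixed_partial_le\<close>.\<close>

locale mapped_grid_function = mapped_grid +
  fixes \<gamma> :: "nat set \<Rightarrow> real" and F :: "(nat \<Rightarrow> real) \<Rightarrow> real"
  assumes mixed: "has_mixed_partials d a b F"
    and mixed_bound: "\<And>u x. u \<subseteq> {1..d} \<Longrightarrow> x \<in> cuboid d a b \<Longrightarrow> \<bar>mixed_partial a b u F x\<bar> \<le> \<gamma> u"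
begin

text \<open>Coordinates in \<open>u\<close> are estimated through derivatives, the others trivially.
  Together both produce \<open>(2 ^ m) ^ d\<close>, which cancels the normalization.\<close>

lemma walsh_coeff_bound:
  assumes u: "u \<subseteq> {1..d}" and k0: "\<And>i. i \<in> {1..d} - u \<Longrightarrow> k i = 0"
    and k: "\<And>i. i \<in> u \<Longrightarrow> 0 < k i \<and> k i < 2 ^ m"
  shows "\<bar>walsh_coeff F k\<bar> \<le> \<gamma> u * (\<Prod>i\<in>u. b i - a i) * (1 / 2 ^ (\<Sum>i\<in>u. dyadic_mu (k i)))"
proof -
  have fin: "finite u" using u finite_subset by blast
  define x where "x = grid_point (\<lambda>_. 0)"
  have x: "x \<in> cuboid d a b" unfolding x_def by (intro grid_point_in_cuboid) simp
  \<comment> \<open>The transforms over \<open>ks\<close> act on \<open>F\<close> first, and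
    \<open>ks\<close> is sorted so that its derivatives are those of
    \<open>mixed_partial\<close>.\<close>
  define ks js where "ks = sorted_list_of_set u" and "js = sorted_list_of_set ({1..d} - u)"
  have ks: "set ks = u" "distinct ks" using fin by (simp_all add: ks_def)
  have js: "set js = {1..d} - u" "distinct js" "length js = d - card u"
    using u fin by (simp_all add: js_def card_Diff_subset)
  have card: "card u \<le> d" using card_mono[OF _ u] by simp
  have set: "set (js @ ks) = {1..d}" using ks js u by auto
  have "\<bar>walsh_op m k C ks F y\<bar> \<le> \<gamma> u * (\<Prod>i\<in>u. 2 ^ (m - dyadic_mu (k i)) * (b i - a i))"
    if "y \<in> cuboid d a b" for y
    using walsh_op_bound[of ks k F "\<gamma> u" y] mixed mixed_bound[OF u] u k ks that
    by (auto simp: has_mixed_partials_def mixed_partial_def ks_def)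
  then have "\<bar>walsh_op m k C js (walsh_op m k C ks F) x\<bar>
      \<le> (2 ^ m) ^ length js * (\<gamma> u * (\<Prod>i\<in>u. 2 ^ (m - dyadic_mu (k i)) * (b i - a i)))"
    by (intro walsh_op_trivial_bound x) (auto simp: js)
  moreover have "walsh_op m k C js (walsh_op m k C ks F) x = (2 ^ m) ^ d * walsh_coeff F k"
  proof -
    have "(\<lambda>i. if i \<in> {1..d} then C i (j i) else x i) = grid_point j" for j
      by (auto simp: grid_point_def x_def)
    moreover have "distinct (js @ ks)" using js ks by auto
    ultimately show ?thesis
      by (simp only: walsh_op_append[symmetric] walsh_op_eq_sum set) (simp add: walsh_coeff_def)
  qed
  moreover have "(\<Prod>i\<in>u. 2 ^ (m - dyadic_mu (k i)) * (b i - a i))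
      = (2 ^ m) ^ card u * ((\<Prod>i\<in>u. b i - a i) * (1 / 2 ^ (\<Sum>i\<in>u. dyadic_mu (k i))))"
  proof -
    have "(2::real) ^ (m - dyadic_mu (k i)) = 2 ^ m * (1 / 2 ^ dyadic_mu (k i))" if "i \<in> u" for i
      using dyadic_mu_le[of "k i" m] k[OF that] by (simp add: power_diff)
    then have "(\<Prod>i\<in>u. (2::real) ^ (m - dyadic_mu (k i))) = (\<Prod>i\<in>u. 2 ^ m * (1 / 2 ^ dyadic_mu (k i)))"
      by (intro prod.cong refl)
    then show ?thesis by (simp add: prod.distrib power_sum prod_dividef)
  qed
  ultimately have "(2 ^ m) ^ d * \<bar>walsh_coeff F k\<bar> \<le> (2 ^ m) ^ (d - card u) * (\<gamma> u *
      ((2 ^ m) ^ card u * ((\<Prod>i\<in>u. b i - a i) * (1 / 2 ^ (\<Sum>i\<in>u. dyadic_mu (k i))))))"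
    by (simp only: abs_mult js) simp
  also have "\<dots> = (2 ^ m) ^ (d - card u + card u) *
      (\<gamma> u * (\<Prod>i\<in>u. b i - a i) * (1 / 2 ^ (\<Sum>i\<in>u. dyadic_mu (k i))))"
    unfolding power_add by (simp only: mult_ac)
  also have "d - card u + card u = d" using card by simp
  finally show ?thesis by (simp only: mult_le_cancel_left_pos zero_less_power zero_less_numeral)
qed

text \<open>Expanding \<open>F\<close> turns the quadrature rule into Walsh coefficients times Walsh
  means of the points. The empty support gives the grid average, so only nonempty \<open>u\<close>
  remain in the difference.\<close>

lemma grid_quadrature_error:
  fixes J :: "'h \<Rightarrow> nat \<Rightarrow> nat"
  assumes H: "finite H" "card H = 2 ^ m" and J: "\<And>h i. h \<in> H \<Longrightarrow> i \<in> {1..d} \<Longrightarrow> J h i < 2 ^ m"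
  shows "\<bar>1 / 2 ^ m * (\<Sum>h\<in>H. F (grid_point (J h))) - 1 / (2 ^ m) ^ d * (\<Sum>j\<in>grid. F (grid_point j))\<bar>
    \<le> (\<Sum>u\<in>Pow {1..d} - {{}}. \<gamma> u * (\<Prod>i\<in>u. b i - a i) *
         (\<Sum>k\<in>Pi\<^sub>E u (\<lambda>_. {1..2 ^ m - 1}). (1 / 2 ^ (\<Sum>i\<in>u. dyadic_mu (k i))) *
            \<bar>1 / 2 ^ m * (\<Sum>h\<in>H. \<Prod>i\<in>u. walsh (k i) (real (J h i) / 2 ^ m))\<bar>))"
proof -
  define A where "A k = 1 / 2 ^ m * (\<Sum>h\<in>H. \<Prod>i=1..d. walsh (k i) (real (J h i) / 2 ^ m))" for k
  define ext where "ext u k = (\<lambda>i\<in>{1..d}. if i \<in> u then k i else 0)" for u and k :: "nat \<Rightarrow> nat"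
  define E where "E u = (\<Sum>k\<in>Pi\<^sub>E u (\<lambda>_. {1..2 ^ m - 1}). walsh_coeff F (ext u k) * A (ext u k))" for u
  have "1 / 2 ^ m * (\<Sum>h\<in>H. F (grid_point (J h))) = (\<Sum>k\<in>grid. walsh_coeff F k * A k)"
  proof -
    have "(\<Sum>h\<in>H. F (grid_point (J h)))
        = (\<Sum>h\<in>H. \<Sum>k\<in>grid. walsh_coeff F k * (\<Prod>i=1..d. walsh (k i) (real (J h i) / 2 ^ m)))"
      using J by (intro sum.cong refl walsh_expansion)
    then show ?thesis
      by (simp only: sum.swap[of _ grid] A_def sum_distrib_left mult.left_commute)
  qed
  also have "\<dots> = (\<Sum>u\<in>Pow {1..d}. E u)"
    unfolding E_def ext_def by (rule sum_grid_by_support)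
  also have "\<dots> = E {} + (\<Sum>u\<in>Pow {1..d} - {{}}. E u)"
    by (subst sum.remove[of _ "{}"]) auto
  \<comment> \<open>For \<open>u = {}\<close> all indices are 0 and all Walsh functions are 1; as
    \<open>card H = 2 ^ m\<close>, the mean is 1.\<close>
  also have "E {} = 1 / (2 ^ m) ^ d * (\<Sum>j\<in>grid. F (grid_point j))"
    using H(2) by (simp add: E_def ext_def A_def walsh_coeff_def)
  finally have "\<bar>1 / 2 ^ m * (\<Sum>h\<in>H. F (grid_point (J h))) - 1 / (2 ^ m) ^ d * (\<Sum>j\<in>grid. F (grid_point j))\<bar>
    = \<bar>\<Sum>u\<in>Pow {1..d} - {{}}. E u\<bar>" by simp
  also have "\<dots> \<le> (\<Sum>u\<in>Pow {1..d} - {{}}. \<Sum>k\<in>Pi\<^sub>E u (\<lambda>_. {1..2 ^ m - 1}). \<bar>walsh_coeff F (ext u k)\<bar> * \<bar>A (ext u k)\<bar>)"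
    unfolding E_def abs_mult[symmetric] by (intro order.trans[OF sum_abs] sum_mono sum_abs)
  also have "\<dots> \<le> (\<Sum>u\<in>Pow {1..d} - {{}}. \<Sum>k\<in>Pi\<^sub>E u (\<lambda>_. {1..2 ^ m - 1}).
      \<gamma> u * (\<Prod>i\<in>u. b i - a i) * (1 / 2 ^ (\<Sum>i\<in>u. dyadic_mu (k i))) *
      \<bar>1 / 2 ^ m * (\<Sum>h\<in>H. \<Prod>i\<in>u. walsh (k i) (real (J h i) / 2 ^ m))\<bar>)"
  proof (rule sum_mono, rule sum_mono)
    fix u k assume "u \<in> Pow {1..d} - {{}}" and k: "k \<in> Pi\<^sub>E u (\<lambda>_. {1..2 ^ m - 1 :: nat})"
    then have u: "u \<subseteq> {1..d}" by simp
    have k': "0 < k i \<and> k i < 2 ^ m" if "i \<in> u" for i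
      using PiE_mem[OF k that] unfolding atLeastAtMost_iff le_power_minus_1_iff by simp
    have ext: "ext u k i = k i" if "i \<in> u" for i using that u by (auto simp: ext_def)
    have ext0: "ext u k i = 0" if "i \<in> {1..d} - u" for i using that by (auto simp: ext_def)
    have "\<bar>walsh_coeff F (ext u k)\<bar> \<le> \<gamma> u * (\<Prod>i\<in>u. b i - a i) * (1 / 2 ^ (\<Sum>i\<in>u. dyadic_mu (ext u k i)))"
      using k' by (intro walsh_coeff_bound u ext0) (simp_all add: ext)
    moreover have "(\<Prod>i=1..d. walsh (ext u k i) (real (J h i) / 2 ^ m))
        = (\<Prod>i\<in>u. walsh (k i) (real (J h i) / 2 ^ m))" for h
      using u by (intro prod.mono_neutral_cong_right) (auto simp: ext ext_def)
    ultimately show "\<bar>walsh_coeff F (ext u k)\<bar> * \<bar>A (ext u k)\<bar>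
      \<le> \<gamma> u * (\<Prod>i\<in>u. b i - a i) * (1 / 2 ^ (\<Sum>i\<in>u. dyadic_mu (k i))) *
        \<bar>1 / 2 ^ m * (\<Sum>h\<in>H. \<Prod>i\<in>u. walsh (k i) (real (J h i) / 2 ^ m))\<bar>"
      by (simp only: A_def ext cong: sum.cong) (intro mult_right_mono abs_ge_zero)
  qed
  finally show ?thesis by (simp only: sum_distrib_left mult.assoc)
qed

end


subsection \<open>Cells of a grid\<close>

lemma prod_indicator_eq_0:
  assumes "finite I" "i \<in> I" "x i \<notin> A i"
  shows "(\<Prod>i\<in>I. indicator (A i) (x i) * f i) = (0 :: real)"
  using assms by (intro prod_zero) (auto intro!: bexI[of _ i])

context mapped_grid
begin

text \<open>Cells are open on the left except the first, so they partition the interval exactly. As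
  differences of initial intervals, their masses are differences of values of
  \<open>cdf_on\<close>.\<close>

definition cell :: "nat \<Rightarrow> nat \<Rightarrow> real set" where
  "cell i j = {a i..C i (Suc j)} - (if j = 0 then {} else {a i..C i j})"

lemma sum_indicator_cell:
  assumes "i \<in> {1..d}"
  shows "(\<Sum>j<2 ^ m. indicator (cell i j) t) = (indicator {a i..b i} t :: real)"
proof -
  \<comment> \<open>The case \<open>n = 0\<close> is separate because \<open>{a i..C i 0}\<close> is
    a point, not the empty set.\<close>
  have "(\<Sum>j<n. indicator (cell i j) t) = (if n = 0 then 0 else indicator {a i..C i n} t :: real)"
    if "n \<le> 2 ^ m" for n
    using that
  proof (induction n)
    case (Suc n)
    then show ?case
      using C_mono[OF assms, of n "Suc n"] by (auto simp: cell_def indicator_def)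
  qed simp
  from this[of "2 ^ m"] show ?thesis using C_power[OF assms] by simp
qed

lemma cell_bounds:
  assumes "i \<in> {1..d}" "j < 2 ^ m" "t \<in> cell i j"
  shows "t \<in> {C i j..C i (Suc j)}" "t \<in> {a i..b i}"
  using assms C_0[OF assms(1)] C_bounds[OF assms(1), of "Suc j"]
  by (auto simp: cell_def split: if_splits)

lemma sum_cell_weights:
  "(\<Sum>j\<in>grid. \<Prod>i=1..d. indicator (cell i (j i)) (x i)) = (\<Prod>i=1..d. indicator {a i..b i} (x i) :: real)"
proof -
  have "(\<Prod>i=1..d. indicator {a i..b i} (x i) :: real) = (\<Prod>i=1..d. \<Sum>j<2 ^ m. indicator (cell i j) (x i))"
    by (intro prod.cong refl) (simp only: sum_indicator_cell)
  also have "\<dots> = (\<Sum>j\<in>grid. \<Prod>i=1..d. indicator (cell i (j i)) (x i))"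
    by (rule prod_sum_PiE) simp_all
  finally show ?thesis by simp
qed

lemma prod_indicator_cuboid:
  assumes "x \<in> extensional {1..d}"
  shows "(\<Prod>i=1..d. indicator {a i..b i} (x i)) = (indicator (cuboid d a b) x :: real)"
proof (cases "x \<in> cuboid d a b")
  case True
  then show ?thesis by (auto simp: cuboid_def PiE_iff intro!: prod.neutral)
next
  case False
  then obtain i where "i \<in> {1..d}" "x i \<notin> {a i..b i}"
    using assms by (auto simp: cuboid_def PiE_iff)
  then have "(\<Prod>i=1..d. indicator {a i..b i} (x i)) = (0::real)"
    using prod_indicator_eq_0[of "{1..d}" i x "\<lambda>i. {a i..b i}" "\<lambda>_. 1"] by simp
  then show ?thesis using False by simp
qed

definition cell_width :: "nat \<Rightarrow> nat \<Rightarrow> real" where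
  "cell_width i j = C i (Suc j) - C i j"

lemma sum_cell_width: "i \<in> {1..d} \<Longrightarrow> (\<Sum>j<2 ^ m. cell_width i j) = b i - a i"
  unfolding cell_width_def by (subst sum_lessThan_telescope) (simp add: C_0 C_power)

end

context mapped_grid_function
begin

section \<open>Oscillation of the integrand on cells\<close>

lemma weight_nonneg: "u \<subseteq> {1..d} \<Longrightarrow> 0 \<le> \<gamma> u"
  using mixed_bound[of u "grid_point (\<lambda>_. 0)"] grid_point_in_cuboid[of "\<lambda>_. 0"] by fastforce

lemma abs_diff_coordinate_le:
  assumes i: "i \<in> {1..d}" and x: "x \<in> cuboid d a b" and s: "s \<in> {a i..b i}"
  shows "\<bar>F x - F (x(i := s))\<bar> \<le> \<gamma> {i} * \<bar>x i - s\<bar>"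
proof -
  have exists: "iter_partial_exists d a b [i] F"
    using mixed[unfolded has_mixed_partials_def, rule_format, of "{i}"] i by simp
  have F': "((\<lambda>t. F (y(i := t))) has_real_derivative mixed_partial a b {i} F y) (at (y i) within {a i..b i})"
    if "y \<in> cuboid d a b" for y
    using exists that
    by (simp add: mixed_partial_def has_real_derivative_iff_has_vector_derivative vector_derivative_works)
  have "((\<lambda>t. F (x(i := t))) has_real_derivative mixed_partial a b {i} F (x(i := t))) (at t within {a i..b i})"
    if "t \<in> {a i..b i}" for t
    using F'[OF cuboid_fun_upd[OF x i that]] by simp
  moreover have "norm (mixed_partial a b {i} F (x(i := t))) \<le> \<gamma> {i}" if "t \<in> {a i..b i}" for t
    using mixed_bound[of "{i}" "x(i := t)"] i cuboid_fun_upd[OF x i that] by simp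
  ultimately have "norm (F (x(i := x i)) - F (x(i := s))) \<le> \<gamma> {i} * norm (x i - s)"
    by (rule field_differentiable_bound[OF convex_real_interval(5)]) (use s cuboidD[OF x i] in auto)
  then show ?thesis by simp
qed

lemma abs_diff_le:
  assumes x: "x \<in> cuboid d a b" and y: "y \<in> cuboid d a b"
  shows "\<bar>F x - F y\<bar> \<le> (\<Sum>i=1..d. \<gamma> {i} * \<bar>x i - y i\<bar>)"
proof -
  \<comment> \<open>Passing from \<open>y\<close> to \<open>x\<close> by exchanging one coordinate
    at a time; every intermediate point stays in the cuboid.\<close>
  define z where "z n i = (if i \<le> n then x i else y i)" for n i
  have z: "z n \<in> cuboid d a b" for n
    using x y by (auto simp: z_def cuboid_def PiE_iff extensional_def)
  have "\<bar>F (z n) - F y\<bar> \<le> (\<Sum>i=1..n. \<gamma> {i} * \<bar>x i - y i\<bar>)" if "n \<le> d" for n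
    using that
  proof (induction n)
    case 0
    \<comment> \<open>Index 0 lies outside \<open>{1..d}\<close>, where both points take the default
      value.\<close>
    have "x 0 = y 0" using x y by (auto simp: cuboid_def PiE_iff extensional_def)
    then have "z 0 = y" by (auto simp: z_def)
    then show ?case by simp
  next
    case (Suc n)
    have n: "Suc n \<in> {1..d}" using Suc.prems by simp
    have "(z (Suc n))(Suc n := y (Suc n)) = z n" by (auto simp: z_def fun_eq_iff)
    then have "\<bar>F (z (Suc n)) - F (z n)\<bar> \<le> \<gamma> {Suc n} * \<bar>x (Suc n) - y (Suc n)\<bar>"
      using abs_diff_coordinate_le[OF n z cuboidD[OF y n], of "Suc n"] by (simp add: z_def)
    then show ?case using Suc by simp
  qed
  from this[of d] moreover have "z d = x"
    using x y by (auto simp: z_def fun_eq_iff cuboid_def PiE_iff extensional_def)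
  ultimately show ?thesis by simp
qed

definition cell_osc :: "(nat \<Rightarrow> nat) \<Rightarrow> real" where
  "cell_osc j = (\<Sum>i=1..d. \<gamma> {i} * cell_width i (j i))"

lemma abs_diff_grid_point_le:
  assumes j: "j \<in> grid" and x: "x \<in> extensional {1..d}" "\<And>i. i \<in> {1..d} \<Longrightarrow> x i \<in> cell i (j i)"
  shows "\<bar>F x - F (grid_point j)\<bar> \<le> cell_osc j"
proof -
  have j': "j i < 2 ^ m" if "i \<in> {1..d}" for i using PiE_mem[OF j that] by simp
  have "x \<in> cuboid d a b"
    using x cell_bounds(2)[OF _ j'] by (force simp: cuboid_def PiE_iff)
  moreover have "grid_point j \<in> cuboid d a b"
    using j' by (intro grid_point_in_cuboid) (simp add: less_imp_le)
  ultimately have "\<bar>F x - F (grid_point j)\<bar> \<le> (\<Sum>i=1..d. \<gamma> {i} * \<bar>x i - grid_point j i\<bar>)"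
    by (rule abs_diff_le)
  also have "\<dots> \<le> cell_osc j"
    unfolding cell_osc_def
  proof (intro sum_mono mult_left_mono weight_nonneg)
    fix i assume i: "i \<in> {1..d}"
    then show "\<bar>x i - grid_point j i\<bar> \<le> cell_width i (j i)"
      using cell_bounds(1)[OF i j'[OF i] x(2)[OF i]] by (simp add: grid_point_def cell_width_def)
  qed simp
  finally show ?thesis .
qed

lemma abs_diff_grid_point_weight_le:
  assumes "j \<in> grid" "x \<in> extensional {1..d}"
  shows "\<bar>(F x - F (grid_point j)) * (\<Prod>i=1..d. indicator (cell i (j i)) (x i))\<bar>
    \<le> cell_osc j * (\<Prod>i=1..d. indicator (cell i (j i)) (x i))"
proof (cases "\<forall>i\<in>{1..d}. x i \<in> cell i (j i)")
  case True
  then show ?thesis using abs_diff_grid_point_le[OF assms] by simp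
next
  case False
  then have "(\<Prod>i=1..d. indicator (cell i (j i)) (x i)) = (0::real)"
    using prod_indicator_eq_0[of "{1..d}" _ x "\<lambda>i. cell i (j i)" "\<lambda>_. 1"] by auto
  then show ?thesis by (simp only: mult_zero_right abs_zero)
qed

section \<open>Measurability by step functions\<close>

definition step_fun :: "(nat \<Rightarrow> real) \<Rightarrow> real" where
  "step_fun x = (\<Sum>j\<in>grid. F (grid_point j) * (\<Prod>i=1..d. indicator (cell i (j i)) (x i)))"

lemma abs_diff_step_fun_le:
  assumes x: "x \<in> extensional {1..d}" and w: "\<And>i j. i \<in> {1..d} \<Longrightarrow> j < 2 ^ m \<Longrightarrow> cell_width i j \<le> w i"
  shows "\<bar>indicator (cuboid d a b) x * F x - step_fun x\<bar> \<le> (\<Sum>i=1..d. \<gamma> {i} * w i)"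
proof -
  have "indicator (cuboid d a b) x * F x - step_fun x
      = (\<Sum>j\<in>grid. (F x - F (grid_point j)) * (\<Prod>i=1..d. indicator (cell i (j i)) (x i)))"
    by (simp only: left_diff_distrib sum_subtractf step_fun_def sum_distrib_left[symmetric]
        sum_cell_weights prod_indicator_cuboid[OF x] mult.commute)
  then have "\<bar>indicator (cuboid d a b) x * F x - step_fun x\<bar>
      \<le> (\<Sum>j\<in>grid. \<bar>(F x - F (grid_point j)) * (\<Prod>i=1..d. indicator (cell i (j i)) (x i))\<bar>)"
    by (simp only: sum_abs)
  also have "\<dots> \<le> (\<Sum>j\<in>grid. (\<Sum>i=1..d. \<gamma> {i} * w i) * (\<Prod>i=1..d. indicator (cell i (j i)) (x i)))"
  proof (intro sum_mono order.trans[OF abs_diff_grid_point_weight_le[OF _ x]] mult_right_mono)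
    fix j assume j: "j \<in> grid"
    show "cell_osc j \<le> (\<Sum>i=1..d. \<gamma> {i} * w i)"
      unfolding cell_osc_def using PiE_mem[OF j]
      by (intro sum_mono mult_left_mono w weight_nonneg) auto
  qed (auto intro: prod_nonneg)
  also have "\<dots> = (\<Sum>i=1..d. \<gamma> {i} * w i) * indicator (cuboid d a b) x"
    by (simp only: sum_distrib_left[symmetric] sum_cell_weights prod_indicator_cuboid[OF x])
  also have "\<dots> \<le> (\<Sum>i=1..d. \<gamma> {i} * w i)"
  proof -
    have "0 \<le> w i" if "i \<in> {1..d}" for i
      using w[OF that, of 0] C_mono[OF that, of 0 1] by (simp add: cell_width_def)
    then have "0 \<le> (\<Sum>i=1..d. \<gamma> {i} * w i)"
      by (intro sum_nonneg mult_nonneg_nonneg weight_nonneg) auto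
    then show ?thesis by (simp add: indicator_def)
  qed
  finally show ?thesis .
qed

lemma measurable_step_fun: "step_fun \<in> borel_measurable (Pi\<^sub>M {1..d} (\<lambda>_. lebesgue))"
proof -
  have "(\<lambda>x. \<Prod>i=1..d. indicator (cell i (j i)) (x i) :: real) \<in> borel_measurable (Pi\<^sub>M {1..d} (\<lambda>_. lebesgue))"
    for j
  proof (rule borel_measurable_prod)
    fix i assume i: "i \<in> {1..d}"
    have "cell i (j i) \<in> sets lebesgue" by (simp add: cell_def)
    then show "(\<lambda>x. indicator (cell i (j i)) (x i) :: real) \<in> borel_measurable (Pi\<^sub>M {1..d} (\<lambda>_. lebesgue))"
      by (intro measurable_compose[OF measurable_component_singleton[OF i]] borel_measurable_indicator)
  qed
  then show ?thesis
    unfolding step_fun_def by (intro borel_measurable_sum borel_measurable_times borel_measurable_const)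
qed

text \<open>The Lipschitz estimate makes the cut-off function a pointwise limit of measurable step
  functions on grids refined by halving.\<close>

lemma measurable_on_cuboid:
  "(\<lambda>x. indicator (cuboid d a b) x * F x) \<in> borel_measurable (Pi\<^sub>M {1..d} (\<lambda>_. lebesgue))"
proof -
  \<comment> \<open>Equidistant points make the cell widths \<open>(b i - a i) / 2 ^ n\<close>
    explicit, whatever the given \<open>C\<close> is.\<close>
  define U where "U n i j = a i + (b i - a i) * real j / 2 ^ n" for n i j
  have grid: "mapped_grid_function d n a b (U n) \<gamma> F" for n
  proof
    fix i j j' assume i: "i \<in> {1..d}" and "j \<le> j'" "j' \<le> (2::nat) ^ n"
    then show "U n i j \<le> U n i j'"
      using less[OF i] by (simp add: U_def divide_right_mono mult_left_mono)
  qed (use less mixed mixed_bound in \<open>auto simp: U_def\<close>)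
  define S where "S n = mapped_grid_function.step_fun d n a (U n) F" for n
  show ?thesis
  proof (rule borel_measurable_LIMSEQ_real)
    show "S n \<in> borel_measurable (Pi\<^sub>M {1..d} (\<lambda>_. lebesgue))" for n
      unfolding S_def by (rule mapped_grid_function.measurable_step_fun[OF grid])
    fix x assume "x \<in> space (Pi\<^sub>M {1..d} (\<lambda>_. lebesgue :: real measure))"
    then have x: "x \<in> extensional {1..d}" by (simp add: space_PiM PiE_iff)
    have "\<bar>indicator (cuboid d a b) x * F x - S n x\<bar> \<le> (\<Sum>i=1..d. \<gamma> {i} * ((b i - a i) / 2 ^ n))" for n
      unfolding S_def
    proof (rule mapped_grid_function.abs_diff_step_fun_le[OF grid x])
      interpret U: mapped_grid_function d n a b "U n" \<gamma> F by (rule grid)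
      fix i j
      show "U.cell_width i j \<le> (b i - a i) / 2 ^ n"
        by (simp add: U.cell_width_def U_def field_simps)
    qed
    then have le: "norm (S n x - indicator (cuboid d a b) x * F x) \<le> (\<Sum>i=1..d. \<gamma> {i} * (b i - a i)) * (1 / 2) ^ n" for n
      by (simp add: abs_minus_commute sum_divide_distrib power_one_over)
    show "(\<lambda>n. S n x) \<longlonglongrightarrow> indicator (cuboid d a b) x * F x"
    proof (rule LIM_zero_cancel, rule Lim_null_comparison)
      show "\<forall>\<^sub>F n in sequentially. norm (S n x - indicator (cuboid d a b) x * F x)
          \<le> (\<Sum>i=1..d. \<gamma> {i} * (b i - a i)) * (1 / 2) ^ n"
        using le by (intro always_eventually allI)
      show "(\<lambda>n. (\<Sum>i=1..d. \<gamma> {i} * (b i - a i)) * (1 / 2) ^ n) \<longlonglongrightarrow> 0"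
        by (intro tendsto_mult_right_zero LIMSEQ_power_zero) simp
    qed
  qed
qed

text \<open>Quantile cells may differ in width, but along each axis the widths add up to
  \<open>b i - a i\<close>, so their mean is \<open>(b i - a i) / 2 ^ m\<close>.\<close>

lemma sum_grid_cell_osc:
  "1 / (2 ^ m) ^ d * (\<Sum>j\<in>grid. cell_osc j) = 1 / 2 ^ m * (\<Sum>i=1..d. \<gamma> {i} * (b i - a i))"
proof -
  have "(\<Sum>j\<in>grid. cell_width i (j i)) = (2 ^ m) ^ (d - 1) * (b i - a i)" if i: "i \<in> {1..d}" for i
  proof -
    \<comment> \<open>The width is padded with factors 1 so that the sum over the grid factors by
      \<open>prod_sum_PiE\<close>.\<close>
    have "(\<Sum>j\<in>grid. cell_width i (j i)) = (\<Sum>j\<in>grid. \<Prod>l=1..d. if l = i then cell_width i (j l) else 1)"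
      using i by (intro sum.cong refl) (simp add: prod.delta)
    also have "\<dots> = (\<Prod>l=1..d. \<Sum>t<2 ^ m. if l = i then cell_width i t else 1)"
      by (rule prod_sum_PiE[symmetric]) simp_all
    also have "\<dots> = (\<Prod>l=1..d. if l = i then b i - a i else 2 ^ m)"
      by (intro prod.cong refl) (auto simp: sum_cell_width[OF i])
    also have "\<dots> = (2 ^ m) ^ (d - 1) * (b i - a i)"
      using i by (simp add: prod.remove[of _ i])
    finally show ?thesis .
  qed
  then have "(\<Sum>j\<in>grid. cell_osc j) = (\<Sum>i=1..d. \<gamma> {i} * ((2 ^ m) ^ (d - 1) * (b i - a i)))"
    unfolding cell_osc_def by (subst sum.swap) (simp add: sum_distrib_left[symmetric])
  also have "\<dots> = (2 ^ m) ^ (d - 1) * (\<Sum>i=1..d. \<gamma> {i} * (b i - a i))"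
    by (simp only: sum_distrib_left mult_ac)
  \<comment> \<open>For \<open>d = 0\<close> the exponent \<open>d - 1\<close> is truncated, but
    both sides vanish.\<close>
  finally show ?thesis
    by (cases d) simp_all
qed

end


subsection \<open>Integration over the cuboid\<close>

text \<open>Completion does not change the measure of Borel sets, so a countable cover for
  \<open>lborel\<close> also serves here. Product integration requires this property of each
  factor.\<close>

lemma sigma_finite_lebesgue: "sigma_finite_measure (lebesgue :: 'a :: euclidean_space measure)"
proof -
  obtain A :: "'a set set" where A: "countable A" "A \<subseteq> sets lborel" "\<Union>A = space lborel"
    "\<forall>S\<in>A. emeasure lborel S \<noteq> \<infinity>"
    using sigma_finite_measure.sigma_finite_countable[OF sigma_finite_lborel] by blast
  have "emeasure lebesgue S \<noteq> \<infinity>" if "S \<in> A" for S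
    using A(2,4) that by (subst emeasure_completion) (simp_all add: subset_iff)
  moreover have "A \<subseteq> sets lebesgue"
    using A(2) by (blast intro: sets_completionI_sets)
  ultimately show ?thesis
    using A(1,3) by unfold_locales (metis space_completion)
qed

lemma set_integral_Diff:
  fixes \<psi> :: "real \<Rightarrow> real"
  assumes "set_integrable M A \<psi>" "B \<in> sets M" "B \<subseteq> A"
  shows "(LINT t:A - B|M. \<psi> t) = (LINT t:A|M. \<psi> t) - (LINT t:B|M. \<psi> t)"
proof -
  have "set_integrable M B \<psi>" using assms by (rule set_integrable_subset)
  moreover have "indicator (A - B) t *\<^sub>R \<psi> t = indicator A t *\<^sub>R \<psi> t - indicator B t *\<^sub>R \<psi> t" for t
    using assms(3) by (auto simp: indicator_def)
  ultimately show ?thesis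
    using assms(1) unfolding set_lebesgue_integral_def set_integrable_def
    by (simp only: Bochner_Integration.integral_diff)
qed

lemma cdf_on_mono:
  assumes "prob_density_on l r \<psi>" "x \<le> y" "y \<le> r"
  shows "cdf_on l \<psi> x \<le> cdf_on l \<psi> y"
proof -
  have "set_integrable lebesgue {l..z} \<psi>" if "z \<le> r" for z
    using assms(1) that by (auto simp: prob_density_on_def intro: set_integrable_subset)
  then have "(LINT t|lebesgue. indicator {l..x} t *\<^sub>R \<psi> t) \<le> (LINT t|lebesgue. indicator {l..y} t *\<^sub>R \<psi> t)"
    using assms by (intro integral_mono) (auto simp: set_integrable_def prob_density_on_def indicator_def)
  then show ?thesis by (simp add: cdf_on_def set_lebesgue_integral_def)
qed

locale quantile_grid = mapped_grid_function +
  fixes \<phi> :: "nat \<Rightarrow> real \<Rightarrow> real"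
  assumes density: "\<And>i. i \<in> {1..d} \<Longrightarrow> prob_density_on (a i) (b i) (\<phi> i)"
    and cdf_C: "\<And>i j. i \<in> {1..d} \<Longrightarrow> j \<le> 2 ^ m \<Longrightarrow> cdf_on (a i) (\<phi> i) (C i j) = real j / 2 ^ m"
begin

section \<open>Masses of the cells\<close>

lemma set_integrable_initial:
  assumes "i \<in> {1..d}" "t \<le> b i"
  shows "set_integrable lebesgue {a i..t} (\<phi> i)"
  using density[OF assms(1)] assms(2) by (auto simp: prob_density_on_def intro: set_integrable_subset)

lemma
  assumes i: "i \<in> {1..d}" and j: "j < 2 ^ m"
  shows set_integrable_cell: "set_integrable lebesgue (cell i j) (\<phi> i)"
    and integral_cell: "(LINT t:cell i j|lebesgue. \<phi> i t) = 1 / 2 ^ m"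
proof -
  have Suc: "Suc j \<le> 2 ^ m" using j by simp
  have int: "set_integrable lebesgue {a i..C i (Suc j)} (\<phi> i)"
    using C_bounds[OF i Suc] by (intro set_integrable_initial i) simp
  then show "set_integrable lebesgue (cell i j) (\<phi> i)"
    by (rule set_integrable_subset) (auto simp: cell_def)
  have "(LINT t:{a i..C i (Suc j)}|lebesgue. \<phi> i t) = real (Suc j) / 2 ^ m"
    using cdf_C[OF i Suc] by (simp add: cdf_on_def)
  moreover have "(LINT t:{a i..C i j}|lebesgue. \<phi> i t) = real j / 2 ^ m"
    using cdf_C[OF i, of j] j by (simp add: cdf_on_def)
  moreover have "{a i..C i j} \<subseteq> {a i..C i (Suc j)}"
    using C_mono[OF i _ Suc, of j] by auto
  ultimately show "(LINT t:cell i j|lebesgue. \<phi> i t) = 1 / 2 ^ m"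
    using int by (cases "j = 0") (simp_all add: cell_def set_integral_Diff field_simps)
qed

text \<open>The density cut off to a cell, as a product of functions of one variable so that its
  integral factors.\<close>

definition cell_density :: "(nat \<Rightarrow> nat) \<Rightarrow> (nat \<Rightarrow> real) \<Rightarrow> real" where
  "cell_density j x = (\<Prod>i=1..d. indicator (cell i (j i)) (x i) * \<phi> i (x i))"

lemma cell_density_eq_0: "i \<in> {1..d} \<Longrightarrow> x i \<notin> cell i (j i) \<Longrightarrow> cell_density j x = 0"
  unfolding cell_density_def by (rule prod_indicator_eq_0[where i = i]) simp_all

lemma
  assumes j: "j \<in> grid"
  shows integrable_cell_density: "integrable (Pi\<^sub>M {1..d} (\<lambda>_. lebesgue)) (cell_density j)"
    and integral_cell_density: "(LINT x|Pi\<^sub>M {1..d} (\<lambda>_. lebesgue). cell_density j x) = 1 / (2 ^ m) ^ d"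
proof -
  interpret product_sigma_finite "\<lambda>_ :: nat. lebesgue :: real measure"
    by (simp add: product_sigma_finite_def sigma_finite_lebesgue)
  have j': "j i < 2 ^ m" if "i \<in> {1..d}" for i using PiE_mem[OF j that] by simp
  have int: "integrable lebesgue (\<lambda>t. indicator (cell i (j i)) t * \<phi> i t)" if "i \<in> {1..d}" for i
    using set_integrable_cell[OF that j'[OF that]] by (simp add: set_integrable_def)
  show "integrable (Pi\<^sub>M {1..d} (\<lambda>_. lebesgue)) (cell_density j)"
    unfolding cell_density_def using int by (intro product_integrable_prod) auto
  have "(LINT x|Pi\<^sub>M {1..d} (\<lambda>_. lebesgue). cell_density j x)
      = (\<Prod>i=1..d. LINT t|lebesgue. indicator (cell i (j i)) t * \<phi> i t)"
    unfolding cell_density_def using int by (intro product_integral_prod) auto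
  also have "\<dots> = (\<Prod>i=1..d. 1 / 2 ^ m)"
    using integral_cell j' by (intro prod.cong refl) (simp add: set_lebesgue_integral_def)
  finally show "(LINT x|Pi\<^sub>M {1..d} (\<lambda>_. lebesgue). cell_density j x) = 1 / (2 ^ m) ^ d"
    by (simp add: power_one_over)
qed

lemma cell_density_eq:
  "cell_density j x = (\<Prod>i=1..d. indicator (cell i (j i)) (x i)) * (\<Prod>i=1..d. \<phi> i (x i))"
  by (simp add: cell_density_def prod.distrib)

lemma abs_diff_cell_density_le:
  assumes j: "j \<in> grid" and x: "x \<in> extensional {1..d}"
  shows "\<bar>(F x - F (grid_point j)) * cell_density j x\<bar> \<le> cell_osc j * cell_density j x"
proof (cases "\<forall>i\<in>{1..d}. x i \<in> cell i (j i)")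
  case True
  have "0 \<le> cell_density j x"
    unfolding cell_density_def
  proof (intro prod_nonneg)
    fix i assume i: "i \<in> {1..d}"
    have "x i \<in> {a i..b i}" using cell_bounds(2)[OF i _] PiE_mem[OF j i] True i by blast
    then show "0 \<le> indicator (cell i (j i)) (x i) * \<phi> i (x i)"
      using density[OF i] by (simp add: prob_density_on_def)
  qed
  then show ?thesis
    using abs_diff_grid_point_le[OF j x] True by (simp add: abs_mult mult_right_mono)
next
  case False
  then have "cell_density j x = 0"
    using cell_density_eq_0 by blast
  then show ?thesis by simp
qed

text \<open>Every cell has mass \<open>1 / (2 ^ m) ^ d\<close>, so the grid average integrates the
  step function with values \<open>F (grid_point j)\<close>. The error is at most the sum of
  oscillation times mass.\<close>

lemma integral_error:
  "\<bar>1 / (2 ^ m) ^ d * (\<Sum>j\<in>grid. F (grid_point j))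
     - (LINT x:cuboid d a b|Pi\<^sub>M {1..d} (\<lambda>_. lebesgue). F x * (\<Prod>i=1..d. \<phi> i (x i)))\<bar>
   \<le> 1 / 2 ^ m * (\<Sum>i=1..d. \<gamma> {i} * (b i - a i))"
proof -
  let ?M = "Pi\<^sub>M {1..d} (\<lambda>_. lebesgue :: real measure)"
  define \<Delta> where "\<Delta> j x = (F x - F (grid_point j)) * cell_density j x" for j x
  have ext: "x \<in> extensional {1..d}" if "x \<in> space ?M" for x
    using that by (simp add: space_PiM PiE_iff)
  have \<Delta>_le: "\<bar>\<Delta> j x\<bar> \<le> cell_osc j * cell_density j x" if "j \<in> grid" "x \<in> space ?M" for j x
    unfolding \<Delta>_def using that ext by (intro abs_diff_cell_density_le)
  have int_\<Delta>: "integrable ?M (\<Delta> j)" if j: "j \<in> grid" for j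
  proof (rule Bochner_Integration.integrable_bound)
    show "integrable ?M (\<lambda>x. cell_osc j * cell_density j x)"
      using integrable_cell_density[OF j] by (rule integrable_mult_right)
    \<comment> \<open>\<open>F\<close> is known to be measurable only after multiplication by the
      indicator of the cuboid, which may be inserted because \<open>cell_density j\<close> vanishes
      outside.\<close>
    have "cell_density j x = indicator (cuboid d a b) x * cell_density j x" if "x \<in> space ?M" for x
    proof (cases "\<forall>i\<in>{1..d}. x i \<in> cell i (j i)")
      case True
      have "x i \<in> {a i..b i}" if "i \<in> {1..d}" for i
        using cell_bounds(2)[OF that _] PiE_mem[OF j that] True that by blast
      then have "x \<in> cuboid d a b" using ext[OF that] by (auto simp: cuboid_def PiE_iff)
      then show ?thesis by simp
    next
      case False
      then have "cell_density j x = 0"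
        using cell_density_eq_0 by blast
      then show ?thesis by simp
    qed
    then have \<Delta>_eq: "\<Delta> j x = (indicator (cuboid d a b) x * F x) * cell_density j x - F (grid_point j) * cell_density j x"
      if "x \<in> space ?M" for x
      using that unfolding \<Delta>_def by (simp add: left_diff_distrib) (metis mult.assoc mult.commute)
    have "(\<lambda>x. (indicator (cuboid d a b) x * F x) * cell_density j x - F (grid_point j) * cell_density j x)
        \<in> borel_measurable ?M"
      using borel_measurable_integrable[OF integrable_cell_density[OF j]]
      by (intro borel_measurable_diff borel_measurable_times measurable_on_cuboid borel_measurable_const)
    then show "\<Delta> j \<in> borel_measurable ?M"
      by (subst measurable_cong[OF \<Delta>_eq])
    show "AE x in ?M. norm (\<Delta> j x) \<le> norm (cell_osc j * cell_density j x)"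
      using \<Delta>_le[OF j] by (intro AE_I2) (fastforce intro: order.trans)
  qed
  \<comment> \<open>The cell indicators add up to the indicator of the cuboid, so the integral
    splits over the cells.\<close>
  have "(LINT x:cuboid d a b|?M. F x * (\<Prod>i=1..d. \<phi> i (x i)))
      = (LINT x|?M. (\<Sum>j\<in>grid. \<Delta> j x + F (grid_point j) * cell_density j x))"
    unfolding set_lebesgue_integral_def
  proof (rule Bochner_Integration.integral_cong[OF refl])
    fix x assume x: "x \<in> space ?M"
    have "(\<Sum>j\<in>grid. \<Delta> j x + F (grid_point j) * cell_density j x)
        = (\<Sum>j\<in>grid. (F x * (\<Prod>i=1..d. \<phi> i (x i))) * (\<Prod>i=1..d. indicator (cell i (j i)) (x i)))"
      by (intro sum.cong refl) (simp only: \<Delta>_def cell_density_eq, simp add: algebra_simps)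
    also have "\<dots> = indicator (cuboid d a b) x *\<^sub>R (F x * (\<Prod>i=1..d. \<phi> i (x i)))"
      by (simp only: sum_distrib_left[symmetric] sum_cell_weights prod_indicator_cuboid[OF ext[OF x]]
          real_scaleR_def mult.commute)
    finally show "indicator (cuboid d a b) x *\<^sub>R (F x * (\<Prod>i=1..d. \<phi> i (x i)))
        = (\<Sum>j\<in>grid. \<Delta> j x + F (grid_point j) * cell_density j x)" ..
  qed
  also have "\<dots> = (\<Sum>j\<in>grid. (LINT x|?M. \<Delta> j x) + F (grid_point j) * (LINT x|?M. cell_density j x))"
    using int_\<Delta> integrable_cell_density
    by (simp add: Bochner_Integration.integral_sum Bochner_Integration.integral_add)
  also have "\<dots> = (\<Sum>j\<in>grid. (LINT x|?M. \<Delta> j x) + F (grid_point j) * (1 / (2 ^ m) ^ d))"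
    by (intro sum.cong refl) (simp only: integral_cell_density)
  also have "\<dots> = (\<Sum>j\<in>grid. (LINT x|?M. \<Delta> j x)) + 1 / (2 ^ m) ^ d * (\<Sum>j\<in>grid. F (grid_point j))"
    by (simp only: sum.distrib sum_distrib_left mult.commute)
  finally have "\<bar>1 / (2 ^ m) ^ d * (\<Sum>j\<in>grid. F (grid_point j))
     - (LINT x:cuboid d a b|?M. F x * (\<Prod>i=1..d. \<phi> i (x i)))\<bar> = \<bar>\<Sum>j\<in>grid. (LINT x|?M. \<Delta> j x)\<bar>"
    by simp
  also have "\<dots> \<le> (\<Sum>j\<in>grid. (LINT x|?M. cell_osc j * cell_density j x))"
    using \<Delta>_le int_\<Delta> integrable_cell_density
    by (intro order.trans[OF sum_abs] sum_mono order.trans[OF integral_abs_bound] integral_mono) auto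
  also have "\<dots> = 1 / (2 ^ m) ^ d * (\<Sum>j\<in>grid. cell_osc j)"
    unfolding sum_distrib_left
    by (intro sum.cong refl) (simp only: integral_mult_right_zero integral_cell_density mult.commute)
  also have "\<dots> = 1 / 2 ^ m * (\<Sum>i=1..d. \<gamma> {i} * (b i - a i))"
    by (rule sum_grid_cell_osc)
  finally show ?thesis .
qed

end


subsection \<open>Worst-case error of polynomial lattice rules\<close>

lemma abs_mixed_partial_le:
  assumes "mixed_norm d a b \<gamma> F \<le> 1" "u \<subseteq> {1..d}" "0 < \<gamma> u" "x \<in> cuboid d a b"
  shows "\<bar>mixed_partial a b u F x\<bar> \<le> \<gamma> u"
proof -
  have "ereal (1 / \<gamma> u) * ereal \<bar>mixed_partial a b u F x\<bar>
      \<le> ereal (1 / \<gamma> u) * (SUP x\<in>cuboid d a b. ereal \<bar>mixed_partial a b u F x\<bar>)"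
    using assms by (intro ereal_mult_left_mono SUP_upper) auto
  also have "\<dots> \<le> mixed_norm d a b \<gamma> F"
    unfolding mixed_norm_def using assms(2) by (intro Max_ge) auto
  also note assms(1)
  finally show ?thesis using assms(3) by (simp add: field_simps)
qed

lemma merit_poly_lattice:
  assumes m: "degree f = m"
  shows "merit a b \<gamma> d g f = (\<Sum>u\<in>Pow {1..d} - {{}}. \<gamma> u * (\<Prod>i\<in>u. b i - a i) *
    (\<Sum>k\<in>Pi\<^sub>E u (\<lambda>_. {1..2 ^ m - 1}). (1 / 2 ^ (\<Sum>i\<in>u. dyadic_mu (k i))) *
      \<bar>1 / 2 ^ m * (\<Sum>h\<in>polys_below m. \<Prod>i\<in>u. walsh (k i)
        (real (trunc_num m (laurent_of_poly (h * g i) / laurent_of_poly f)) / 2 ^ m))\<bar>))"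
proof -
  have "(\<Sum>y\<in>#poly_lattice d g f. \<Prod>i\<in>u. walsh (k i) (y i))
      = (\<Sum>h\<in>polys_below m. \<Prod>i\<in>u. walsh (k i)
        (real (trunc_num m (laurent_of_poly (h * g i) / laurent_of_poly f)) / 2 ^ m))"
    if "u \<in> Pow {1..d} - {{}}" for u k
    unfolding sum_mset_poly_lattice m
  proof (intro sum.cong[OF refl] prod.cong[OF refl])
    fix h i assume "i \<in> u"
    then have "i \<in> {1..d}" using that by auto
    then show "walsh (k i) ((\<lambda>i\<in>{1..d}. trunc_frac m (laurent_of_poly (h * g i) / laurent_of_poly f)) i)
        = walsh (k i) (real (trunc_num m (laurent_of_poly (h * g i) / laurent_of_poly f)) / 2 ^ m)"
      by (simp only: restrict_apply' trunc_frac_eq)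
  qed
  then show ?thesis
    unfolding merit_def walsh_sum_def m by (intro sum.cong[OF refl] arg_cong2[where f = "(*)"] refl) simp
qed

text \<open>Endpoints and order of the quantiles follow from the bijection: \<open>cdf_on\<close> is
  0 and 1 at the ends and, having a nonnegative density, nondecreasing.\<close>

lemma quantile_grid_the_inv_into:
  assumes less: "\<And>i. i \<in> {1..d} \<Longrightarrow> a i < b i"
    and density: "\<And>i. i \<in> {1..d} \<Longrightarrow> prob_density_on (a i) (b i) (\<phi> i)"
    and bij: "\<And>i. i \<in> {1..d} \<Longrightarrow> bij_betw (cdf_on (a i) (\<phi> i)) {a i..b i} {0..1}"
    and mixed: "has_mixed_partials d a b F"
      "\<And>u x. u \<subseteq> {1..d} \<Longrightarrow> x \<in> cuboid d a b \<Longrightarrow> \<bar>mixed_partial a b u F x\<bar> \<le> \<gamma> u"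
  shows "quantile_grid d m a b
    (\<lambda>i j. the_inv_into {a i..b i} (cdf_on (a i) (\<phi> i)) (real j / 2 ^ m)) \<gamma> F \<phi>"
proof -
  define C where "C i j = the_inv_into {a i..b i} (cdf_on (a i) (\<phi> i)) (real j / 2 ^ m)" for i j
  have inj: "inj_on (cdf_on (a i) (\<phi> i)) {a i..b i}" if "i \<in> {1..d}" for i
    using bij[OF that] by (rule bij_betw_imp_inj_on)
  have unit: "real j / 2 ^ m \<in> {0..1}" if "j \<le> 2 ^ m" for j
  proof -
    have "real j \<le> 2 ^ m" using that by (metis of_nat_le_iff of_nat_numeral of_nat_power)
    then show ?thesis by simp
  qed
  have cdf_C: "cdf_on (a i) (\<phi> i) (C i j) = real j / 2 ^ m" if "i \<in> {1..d}" "j \<le> 2 ^ m" for i j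
    unfolding C_def using unit[OF that(2)] bij[OF that(1)]
    by (intro f_the_inv_into_f_bij_betw) auto
  have C: "C i j \<in> {a i..b i}" if "i \<in> {1..d}" "j \<le> 2 ^ m" for i j
    unfolding C_def using unit[OF that(2)] bij_betw_imp_surj_on[OF bij[OF that(1)]]
    by (intro the_inv_into_into inj that(1)) auto
  have eq: "C i j = t" if "i \<in> {1..d}" "t \<in> {a i..b i}" "cdf_on (a i) (\<phi> i) t = real j / 2 ^ m" for i j t
    unfolding C_def using that by (intro the_inv_into_f_eq inj)
  have "quantile_grid d m a b C \<gamma> F \<phi>"
  proof
    fix i assume i: "i \<in> {1..d}"
    have "cdf_on (a i) (\<phi> i) (a i) = 0"
    proof -
      have "set_integrable lebesgue {a i} (\<phi> i)"
        using density[OF i] less[OF i] by (auto simp: prob_density_on_def intro: set_integrable_subset)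
      then show ?thesis by (simp add: cdf_on_def set_integral_at_point)
    qed
    then show "C i 0 = a i" using less[OF i] by (intro eq i) auto
    have "cdf_on (a i) (\<phi> i) (b i) = 1"
      using density[OF i] by (simp add: cdf_on_def prob_density_on_def)
    then show "C i (2 ^ m) = b i" using less[OF i] by (intro eq i) auto
    fix j j' assume j: "j \<le> j'" "j' \<le> (2::nat) ^ m"
    show "C i j \<le> C i j'"
    proof (rule ccontr)
      \<comment> \<open>Quantiles in the wrong order would force \<open>j' \<le> j\<close>, hence
        \<open>j = j'\<close>, so they would be equal.\<close>
      assume "\<not> C i j \<le> C i j'"
      then have "cdf_on (a i) (\<phi> i) (C i j') \<le> cdf_on (a i) (\<phi> i) (C i j)"
        using C[OF i, of j] j by (intro cdf_on_mono[OF density[OF i]]) auto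
      then have "real j' / 2 ^ m \<le> real j / 2 ^ m" using cdf_C[OF i] j by simp
      then have "j = j'" using j by (simp add: divide_le_cancel)
      then show False using \<open>\<not> C i j \<le> C i j'\<close> by simp
    qed
  qed (use less density cdf_C mixed in auto)
  then show ?thesis by (simp only: C_def[abs_def])
qed

text \<open>Triangle inequality through the average of \<open>F\<close> over the whole grid. The
  generating vector is arbitrary and enters only through \<open>merit\<close>.\<close>

lemma wce_poly_lattice_le:
  assumes f: "degree f = m"
    and less: "\<And>i. i \<in> {1..d} \<Longrightarrow> a i < b i"
    and density: "\<And>i. i \<in> {1..d} \<Longrightarrow> prob_density_on (a i) (b i) (\<phi> i)"
    and bij: "\<And>i. i \<in> {1..d} \<Longrightarrow> bij_betw (cdf_on (a i) (\<phi> i)) {a i..b i} {0..1}"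
    and \<gamma>: "\<And>u. u \<subseteq> {1..d} \<Longrightarrow> 0 < \<gamma> u"
  shows "wce (poly_lattice d g f) d a b \<gamma> \<phi>
    \<le> ereal (merit a b \<gamma> d g f + 1 / 2 ^ m * (\<Sum>i=1..d. \<gamma> {i} * (b i - a i)))"
  unfolding wce_def
proof (rule SUP_least)
  fix F assume "F \<in> {F. has_mixed_partials d a b F \<and> mixed_norm d a b \<gamma> F \<le> 1}"
  then have F: "has_mixed_partials d a b F" "mixed_norm d a b \<gamma> F \<le> 1" by simp_all
  define C where "C i j = the_inv_into {a i..b i} (cdf_on (a i) (\<phi> i)) (real j / 2 ^ m)" for i j
  interpret quantile_grid d m a b C \<gamma> F \<phi>
    unfolding C_def using less density bij F(1) abs_mixed_partial_le[OF F(2) _ \<gamma>]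
    by (rule quantile_grid_the_inv_into)
  define J where "J h i = trunc_num m (laurent_of_poly (h * g i) / laurent_of_poly f)" for h i
  have "size (poly_lattice d g f) = 2 ^ m"
    by (simp add: poly_lattice_def f card_polys_below)
  moreover have "inv_cdf d a b \<phi> (\<lambda>i\<in>{1..d}. trunc_frac m (laurent_of_poly (h * g i) / laurent_of_poly f))
      = grid_point (J h)" for h
    by (auto simp: inv_cdf_def grid_point_def C_def J_def trunc_frac_eq)
  ultimately have quad: "1 / real (size (poly_lattice d g f)) * (\<Sum>y\<in>#poly_lattice d g f. F (inv_cdf d a b \<phi> y))
      = 1 / 2 ^ m * (\<Sum>h\<in>polys_below m. F (grid_point (J h)))"
    unfolding sum_mset_poly_lattice f by simp
  have "\<bar>1 / 2 ^ m * (\<Sum>h\<in>polys_below m. F (grid_point (J h))) - 1 / (2 ^ m) ^ d * (\<Sum>j\<in>grid. F (grid_point j))\<bar>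
      \<le> merit a b \<gamma> d g f"
    unfolding merit_poly_lattice[OF f] J_def[symmetric]
    by (rule grid_quadrature_error) (simp_all add: finite_polys_below card_polys_below J_def trunc_num_less)
  then show "ereal \<bar>1 / real (size (poly_lattice d g f)) * (\<Sum>y\<in>#poly_lattice d g f. F (inv_cdf d a b \<phi> y))
      - (LINT x:cuboid d a b|Pi\<^sub>M {1..d} (\<lambda>_. lebesgue). F x * (\<Prod>i=1..d. \<phi> i (x i)))\<bar>
    \<le> ereal (merit a b \<gamma> d g f + 1 / 2 ^ m * (\<Sum>i=1..d. \<gamma> {i} * (b i - a i)))"
    using integral_error unfolding quad ereal_less_eq by linarith
qed

theorem corollary2:
  fixes s m :: nat
    and a b :: "nat \<Rightarrow> real"
    and \<phi> :: "nat \<Rightarrow> real \<Rightarrow> real"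
    and \<gamma> :: "nat set \<Rightarrow> real"
    and f :: "bit poly"
    and g :: "nat \<Rightarrow> bit poly"
  assumes "1 \<le> s" and "1 \<le> m"
    and "\<And>i. i \<in> {1..s} \<Longrightarrow> a i < b i"
    and "\<And>i. i \<in> {1..s} \<Longrightarrow> prob_density_on (a i) (b i) (\<phi> i)"
    and "\<And>i. i \<in> {1..s} \<Longrightarrow> bij_betw (cdf_on (a i) (\<phi> i)) {a i..b i} {0..1}"
    and "\<And>u. u \<subseteq> {1..s} \<Longrightarrow> 0 < \<gamma> u"
    and "irreducible f" and "degree f = m"
    and "\<And>i. i \<in> {1..s} \<Longrightarrow> g i \<in> polys_below m"
    and "cbc_constructed a b \<gamma> s f g"
  shows "\<forall>d\<in>{1..s}.
    wce (poly_lattice d g f) d a b \<gamma> \<phi>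
      \<le> ereal (1 / 2 ^ m *
          (\<Sum>u\<in>Pow {1..d} - {{}}.
             \<gamma> u * (2 ^ card u + (real m / 2) ^ card u) * (\<Prod>i\<in>u. b i - a i)))"
proof
  fix d assume d: "d \<in> {1..s}"
  then have sub: "{1..d} \<subseteq> {1..s}" by auto
  define c where "c u = \<gamma> u * (\<Prod>i\<in>u. b i - a i)" for u
  have c: "0 \<le> c u" if "u \<subseteq> {1..d}" for u
    unfolding c_def using that sub assms(3,6)
    by (intro mult_nonneg_nonneg prod_nonneg) (simp_all add: less_imp_le subset_iff)
  have "wce (poly_lattice d g f) d a b \<gamma> \<phi>
      \<le> ereal (merit a b \<gamma> d g f + 1 / 2 ^ m * (\<Sum>i=1..d. \<gamma> {i} * (b i - a i)))"
    using assms(3-6) sub by (intro wce_poly_lattice_le assms(8)) blast+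
  also have "\<dots> \<le> ereal (1 / 2 ^ m * (\<Sum>u\<in>Pow {1..d} - {{}}.
      \<gamma> u * (2 ^ card u + (real m / 2) ^ card u) * (\<Prod>i\<in>u. b i - a i)))"
  proof -
    \<comment> \<open>The integration error involves singletons only. As all terms are nonnegative,
      it may be enlarged to all nonempty sets and by the factors \<open>2 ^ card u\<close>.\<close>
    have "(\<Sum>i=1..d. \<gamma> {i} * (b i - a i)) = (\<Sum>u\<in>(\<lambda>i. {i}) ` {1..d}. c u)"
      by (subst sum.reindex) (simp_all add: c_def)
    also have "\<dots> \<le> (\<Sum>u\<in>Pow {1..d} - {{}}. c u)"
      using c by (intro sum_mono2) auto
    also have "\<dots> \<le> (\<Sum>u\<in>Pow {1..d} - {{}}. c u * 2 ^ card u)"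
    proof (rule sum_mono)
      fix u assume "u \<in> Pow {1..d} - {{}}"
      then have "c u * 1 \<le> c u * 2 ^ card u" by (intro mult_left_mono c) auto
      then show "c u \<le> c u * 2 ^ card u" by simp
    qed
    finally have "merit a b \<gamma> d g f + 1 / 2 ^ m * (\<Sum>i=1..d. \<gamma> {i} * (b i - a i))
        \<le> 1 / 2 ^ m * (\<Sum>u\<in>Pow {1..d} - {{}}. \<gamma> u * (real m / 2) ^ card u * (\<Prod>i\<in>u. b i - a i))
          + 1 / 2 ^ m * (\<Sum>u\<in>Pow {1..d} - {{}}. c u * 2 ^ card u)"
      using d by (intro add_mono mult_left_mono merit_cbc_le[OF assms(7,8,3,6,10)]) simp_all
    also have "\<dots> = 1 / 2 ^ m * (\<Sum>u\<in>Pow {1..d} - {{}}.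
        \<gamma> u * (2 ^ card u + (real m / 2) ^ card u) * (\<Prod>i\<in>u. b i - a i))"
      unfolding distrib_left[symmetric] sum.distrib[symmetric]
      by (intro arg_cong2[where f = "(*)"] sum.cong refl) (simp only: c_def ring_distribs mult_ac add.commute)
    finally show ?thesis by (simp only: ereal_less_eq)
  qed
  finally show "wce (poly_lattice d g f) d a b \<gamma> \<phi> \<le> ereal (1 / 2 ^ m *
      (\<Sum>u\<in>Pow {1..d} - {{}}. \<gamma> u * (2 ^ card u + (real m / 2) ^ card u) * (\<Prod>i\<in>u. b i - a i)))" .
qed

end
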